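(* Let $\mathcal Y$ be an antisymmetric coherent configuration and $L$ a transitive permutation group of odd order. Then $gb(\mathcal Y\uparrow L)\le\max\{gb(\mathcal Y),b\}$ where $b=gb(\mathrm{Inv}(L))$. Moreover, if $\mathcal Y$ is not complete, then $b(\mathcal Y\uparrow L)\le b(\mathcal Y)+\max\{0,\,b-\lceil(b(\mathcal Y)-1)/2\rceil\}$.
   Context: A coherent configuration on a finite set $\Omega$ is $(\Omega,S)$ with $S$ a partition of $\Omega\times\Omega$ such that $1_\Omega$ is a union of elements of $S$, $s^*=\{(\beta,\alpha):(\alpha,\beta)\in s\}\in S$, and for $r,s,t\in S$ the number $|\{\gamma:(\alpha,\gamma)\in r,(\gamma,\beta)\in s\}|$ is independent of $(\alpha,\beta)\in t$; relations are unions of elements of $S$, fibers are sets $\Gamma$ with $1_\Gamma\in S$; antisymmetric: every $s\in S$ with $s=s^*$ lies in $1_\Omega$; complete: all elements of $S$ are singletons. A fission is a configuration on the same set whose relations include those of the given one. For $\Pi\subseteq2^\Omega$ the $\Pi$-fission is the smallest fission in which each member of $\Pi$ is a union of fibers; $\Pi$ is a generalized base if the $\Pi$-fission is complete; $B\subseteq\Omega$ is a base if $\{\{\beta\}:\beta\in B\}$ is a generalized base; $gb$ and $b$ are the minimal sizes. $\mathrm{Inv}(L)=(\Delta,\text{orbits of }L\text{ on }\Delta^2)$. Exponentiation: for $\mathcal Y=(\Gamma,T)$ and $L\le\mathrm{Sym}(\Delta)$, $\Delta=\{1,\dots,m\}$, with $t_1\otimes\dots\otimes t_m=\{(\alpha,\beta)\in\Gamma^m\times\Gamma^m:(\alpha_i,\beta_i)\in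 t_i\ \forall i\}$ and $L$ acting on $\Gamma^m$ by permuting coordinates, $\mathcal Y\uparrow L=(\Gamma^m,\{\bigcup_{l\in L}t^l:t=t_1\otimes\dots\otimes t_m,\ t_i\in T\})$. *)

theory Defs
  imports Complex_Main "HOL-Library.Disjoint_Sets" "HOL-Library.FuncSet" "HOL-Combinatorics.Permutations"
begin

definition coherent_config :: "'a set \<Rightarrow> 'a rel set \<Rightarrow> bool" where
  "coherent_config \<Omega> S \<longleftrightarrow>
     finite \<Omega> \<and>
     partition_on (\<Omega> \<times> \<Omega>) S \<and>
     (\<exists>S0 \<subseteq> S. \<Union>S0 = Id_on \<Omega>) \<and>
     (\<forall>s\<in>S. converse s \<in> S) \<and>
     (\<forall>r\<in>S. \<forall>s\<in>S. \<forall>t\<in>S. \<forall>a b a' b'. (a, b) \<in> t \<longrightarrow> (a', b') \<in> t \<longrightarrow>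
        card {c. (a, c) \<in> r \<and> (c, b) \<in> s} = card {c. (a', c) \<in> r \<and> (c, b') \<in> s})"

definition cc_relation :: "'a rel set \<Rightarrow> 'a rel \<Rightarrow> bool" where
  "cc_relation S r \<longleftrightarrow> (\<exists>S0 \<subseteq> S. r = \<Union>S0)"

definition fibers :: "'a rel set \<Rightarrow> 'a set set" where
  "fibers S = {\<Gamma>. Id_on \<Gamma> \<in> S}"

definition cc_antisymmetric :: "'a set \<Rightarrow> 'a rel set \<Rightarrow> bool" where
  "cc_antisymmetric \<Omega> S \<longleftrightarrow> (\<forall>s\<in>S. s = converse s \<longrightarrow> s \<subseteq> Id_on \<Omega>)"

definition cc_complete :: "'a rel set \<Rightarrow> bool" where
  "cc_complete S \<longleftrightarrow> (\<forall>s\<in>S. \<exists>x. s = {x})"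

definition fission :: "'a set \<Rightarrow> 'a rel set \<Rightarrow> 'a rel set \<Rightarrow> bool" where
  "fission \<Omega> S S' \<longleftrightarrow> coherent_config \<Omega> S' \<and> (\<forall>r. cc_relation S r \<longrightarrow> cc_relation S' r)"

definition unions_of_fibers :: "'a rel set \<Rightarrow> 'a set set \<Rightarrow> bool" where
  "unions_of_fibers S' PP \<longleftrightarrow> (\<forall>P\<in>PP. \<exists>F \<subseteq> fibers S'. P = \<Union>F)"

definition is_Pi_fission :: "'a set \<Rightarrow> 'a rel set \<Rightarrow> 'a set set \<Rightarrow> 'a rel set \<Rightarrow> bool" where
  "is_Pi_fission \<Omega> S PP S' \<longleftrightarrow>
     fission \<Omega> S S' \<and> unions_of_fibers S' PP \<and>
     (\<forall>S''. fission \<Omega> S S'' \<and> unions_of_fibers S'' PP \<longrightarrow>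
        (\<forall>r. cc_relation S' r \<longrightarrow> cc_relation S'' r))"

definition generalized_base :: "'a set \<Rightarrow> 'a rel set \<Rightarrow> 'a set set \<Rightarrow> bool" where
  "generalized_base \<Omega> S PP \<longleftrightarrow> PP \<subseteq> Pow \<Omega> \<and> (\<exists>S'. is_Pi_fission \<Omega> S PP S' \<and> cc_complete S')"

definition cc_base :: "'a set \<Rightarrow> 'a rel set \<Rightarrow> 'a set \<Rightarrow> bool" where
  "cc_base \<Omega> S B \<longleftrightarrow> B \<subseteq> \<Omega> \<and> generalized_base \<Omega> S ((\<lambda>x. {x}) ` B)"

definition gb :: "'a set \<Rightarrow> 'a rel set \<Rightarrow> nat" where
  "gb \<Omega> S = (LEAST n. \<exists>PP. generalized_base \<Omega> S PP \<and> card PP = n)"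

definition bnum :: "'a set \<Rightarrow> 'a rel set \<Rightarrow> nat" where
  "bnum \<Omega> S = (LEAST n. \<exists>B. cc_base \<Omega> S B \<and> card B = n)"

definition perm_group_on :: "nat \<Rightarrow> (nat \<Rightarrow> nat) set \<Rightarrow> bool" where
  "perm_group_on m L \<longleftrightarrow> (\<forall>l\<in>L. l permutes {1..m}) \<and> id \<in> L \<and>
     (\<forall>p\<in>L. \<forall>q\<in>L. p \<circ> q \<in> L) \<and> (\<forall>p\<in>L. inv p \<in> L)"

definition transitive_on :: "nat \<Rightarrow> (nat \<Rightarrow> nat) set \<Rightarrow> bool" where
  "transitive_on m L \<longleftrightarrow> (\<forall>i\<in>{1..m}. \<forall>j\<in>{1..m}. \<exists>l\<in>L. l i = j)"

definition Inv_rels :: "nat \<Rightarrow> (nat \<Rightarrow> nat) set \<Rightarrow> nat rel set" where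
  "Inv_rels m L = {{(l i, l j) | l. l \<in> L} | i j. i \<in> {1..m} \<and> j \<in> {1..m}}"

definition tuples :: "nat \<Rightarrow> 'a set \<Rightarrow> (nat \<Rightarrow> 'a) set" where
  "tuples m \<Gamma> = PiE {1..m} (\<lambda>_. \<Gamma>)"

definition perm_tuple :: "(nat \<Rightarrow> nat) \<Rightarrow> (nat \<Rightarrow> 'a) \<Rightarrow> (nat \<Rightarrow> 'a)" where
  "perm_tuple l x = (\<lambda>i. x (inv l i))"

definition perm_rel :: "(nat \<Rightarrow> nat) \<Rightarrow> (nat \<Rightarrow> 'a) rel \<Rightarrow> (nat \<Rightarrow> 'a) rel" where
  "perm_rel l t = {(perm_tuple l a, perm_tuple l b) | a b. (a, b) \<in> t}"

definition tensor :: "nat \<Rightarrow> 'a set \<Rightarrow> (nat \<Rightarrow> 'a rel) \<Rightarrow> (nat \<Rightarrow> 'a) rel" where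
  "tensor m \<Gamma> ts = {(a, b). a \<in> tuples m \<Gamma> \<and> b \<in> tuples m \<Gamma> \<and> (\<forall>i\<in>{1..m}. (a i, b i) \<in> ts i)}"

definition exp_rels :: "nat \<Rightarrow> 'a set \<Rightarrow> 'a rel set \<Rightarrow> (nat \<Rightarrow> nat) set \<Rightarrow> (nat \<Rightarrow> 'a) rel set" where
  "exp_rels m \<Gamma> T L = {\<Union>l\<in>L. perm_rel l (tensor m \<Gamma> ts) | ts. \<forall>i\<in>{1..m}. ts i \<in> T}"

end

theory Submission
  imports Defs "HOL-Analysis.Sigma_Algebra" "HOL-Library.Z2"
begin

text \<open>
  A family of subsets is a generalized base iff every fission \<open>Z\<close> in which its members are unions of
  fibers is complete. So \<open>Z\<close> is arbitrary, and structure has to be recovered from what is visible in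
  \<open>Z\<close>: its relations and its unions of fibers, which are closed under Boolean operations, composition
  and counting.

  Start from a visible box \<open>Q 1 \<times> \<dots> \<times> Q m\<close>, and let \<open>exit i\<close> be the set of tuples that leave the box in
  coordinate \<open>i\<close> only. Hamming distances show that the partition into the sets \<open>exit i\<close> is visible, and
  antisymmetry, by which the pairs leaving and the pairs entering the box are not all of one type,
  makes the orbits of \<open>L\<close> on pairs of indices visible. Hence \<open>Z\<close> induces a fission of \<open>Inv(L)\<close> on the
  indices. Once the members of a generalized base of \<open>Inv(L)\<close> are visible it is complete, so that each
  \<open>exit i\<close> is visible. Then \<open>Z\<close> also induces a fission of the given configuration on every coordinate,
  and it remains to make a (generalized) base of that visible.

  For generalized bases, a single product set encodes both \<open>P \<subseteq> \<Gamma>\<close> and a set \<open>D\<close> of indices: take the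
  factor \<open>P\<close> in the coordinates from \<open>D\<close>, and the symmetric difference of \<open>P\<close> and a fiber \<open>\<Phi>\<close> elsewhere.
  The two factors have different sizes since \<open>card \<Phi>\<close> is odd by antisymmetry. For bases, two base points
  \<open>\<beta>\<close>, \<open>\<beta>'\<close> encode a set \<open>D\<close> for free: use the tuples with entries \<open>\<beta>\<close> (resp. \<open>\<beta>'\<close>) on \<open>D\<close> and \<open>\<beta>'\<close> (resp. \<open>\<beta>\<close>)
  off \<open>D\<close>, as \<open>(\<beta>, \<beta>')\<close> and \<open>(\<beta>', \<beta>)\<close> have different types. Each further \<open>D\<close> costs one more tuple.
\<close>

section \<open>Relations of a coherent configuration\<close>

definition cc_set :: "'a rel set \<Rightarrow> 'a set \<Rightarrow> bool" where
  "cc_set S A \<longleftrightarrow> cc_relation S (Id_on A)"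

lemma cc_relation_iff: "cc_relation S R \<longleftrightarrow> (\<forall>p\<in>R. \<exists>s\<in>S. p \<in> s \<and> s \<subseteq> R)"
proof
  assume "\<forall>p\<in>R. \<exists>s\<in>S. p \<in> s \<and> s \<subseteq> R"
  then have "R = \<Union>{s \<in> S. s \<subseteq> R}" by blast
  then show "cc_relation S R"
    unfolding cc_relation_def by (intro exI[of _ "{s \<in> S. s \<subseteq> R}"]) simp
qed (auto simp: cc_relation_def)

lemma cc_relation_basic: "s \<in> S \<Longrightarrow> cc_relation S s"
  unfolding cc_relation_iff by auto

lemma cc_relation_UN:
  assumes "\<And>i. i \<in> I \<Longrightarrow> cc_relation S (R i)"
  shows "cc_relation S (\<Union>i\<in>I. R i)"
  unfolding cc_relation_iff
proof
  fix p assume "p \<in> (\<Union>i\<in>I. R i)"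
  then obtain i where i: "i \<in> I" "p \<in> R i" by blast
  then obtain s where "s \<in> S" "p \<in> s" "s \<subseteq> R i"
    using assms[OF i(1)] unfolding cc_relation_iff by blast
  then show "\<exists>s\<in>S. p \<in> s \<and> s \<subseteq> (\<Union>i\<in>I. R i)" using i(1) by blast
qed

locale coherent =
  fixes \<Omega> :: "'a set" and S :: "'a rel set"
  assumes coherent: "coherent_config \<Omega> S"
begin

lemma finite_points: "finite \<Omega>"
  and partition: "partition_on (\<Omega> \<times> \<Omega>) S"
  and basic_converse: "s \<in> S \<Longrightarrow> s\<inverse> \<in> S"
  using coherent by (simp_all add: coherent_config_def)

lemma relation_Id: "cc_relation S (Id_on \<Omega>)"
  using coherent unfolding coherent_config_def cc_relation_def by metis

lemma basic_card:
  assumes "r \<in> S" "s \<in> S" "t \<in> S" "(a, b) \<in> t" "(a', b') \<in> t"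
  shows "card {c. (a, c) \<in> r \<and> (c, b) \<in> s} = card {c. (a', c) \<in> r \<and> (c, b') \<in> s}"
  using coherent assms unfolding coherent_config_def by blast

lemma basic_subset: "S \<subseteq> Pow (\<Omega> \<times> \<Omega>)"
  and basic_nonempty: "s \<in> S \<Longrightarrow> s \<noteq> {}"
  and basic_unique: "s \<in> S \<Longrightarrow> t \<in> S \<Longrightarrow> p \<in> s \<Longrightarrow> p \<in> t \<Longrightarrow> s = t"
  and ex_basic: "a \<in> \<Omega> \<Longrightarrow> b \<in> \<Omega> \<Longrightarrow> \<exists>s\<in>S. (a, b) \<in> s"
  using partition by (auto simp: partition_on_def disjoint_def)

lemma finite_basic: "finite S"
  using finite_elements[OF _ partition] finite_points by blast

lemma relation_subset: "cc_relation S R \<Longrightarrow> R \<subseteq> \<Omega> \<times> \<Omega>"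
  using basic_subset unfolding cc_relation_def by blast

lemma relation_finite_Image: "cc_relation S R \<Longrightarrow> finite (R `` A)"
  by (rule finite_subset[OF _ finite_points]) (use relation_subset in blast)

lemma relation_saturated: "cc_relation S R \<Longrightarrow> s \<in> S \<Longrightarrow> p \<in> s \<Longrightarrow> q \<in> s \<Longrightarrow> p \<in> R \<Longrightarrow> q \<in> R"
  unfolding cc_relation_iff using basic_unique by blast

lemma relationI:
  assumes "R \<subseteq> \<Omega> \<times> \<Omega>" "\<And>s p q. s \<in> S \<Longrightarrow> p \<in> s \<Longrightarrow> q \<in> s \<Longrightarrow> p \<in> R \<Longrightarrow> q \<in> R"
  shows "cc_relation S R"
  unfolding cc_relation_iff
proof
  fix p assume "p \<in> R"
  then obtain s where "s \<in> S" "p \<in> s" using assms(1) ex_basic by blast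
  then show "\<exists>s\<in>S. p \<in> s \<and> s \<subseteq> R" using assms(2) \<open>p \<in> R\<close> by blast
qed

lemma relation_full: "cc_relation S (\<Omega> \<times> \<Omega>)"
  and relation_empty: "cc_relation S {}"
  using basic_subset by (auto intro!: relationI)

lemma relation_Un: "cc_relation S R \<Longrightarrow> cc_relation S R' \<Longrightarrow> cc_relation S (R \<union> R')"
  and relation_Int: "cc_relation S R \<Longrightarrow> cc_relation S R' \<Longrightarrow> cc_relation S (R \<inter> R')"
  and relation_Diff: "cc_relation S R \<Longrightarrow> cc_relation S R' \<Longrightarrow> cc_relation S (R - R')"
proof -
  assume R: "cc_relation S R" "cc_relation S R'"
  show "cc_relation S (R \<union> R')" "cc_relation S (R \<inter> R')" "cc_relation S (R - R')"
    using R[THEN relation_subset] relation_saturated[OF R(1)] relation_saturated[OF R(2)]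
    by (intro relationI; blast)+
qed

lemma relation_converse:
  assumes "cc_relation S R"
  shows "cc_relation S (R\<inverse>)"
proof (rule relationI)
  fix s p q assume "s \<in> S" "p \<in> s" "q \<in> s" "p \<in> R\<inverse>"
  then have "prod.swap p \<in> s\<inverse>" "prod.swap q \<in> s\<inverse>" "prod.swap p \<in> R" by (auto simp: prod.swap_def)
  then have "prod.swap q \<in> R" by (rule relation_saturated[OF assms basic_converse[OF \<open>s \<in> S\<close>]])
  then show "q \<in> R\<inverse>" by (cases q) simp
qed (use relation_subset[OF assms] in blast)

lemma relation_card:
  assumes R: "cc_relation S R" and R': "cc_relation S R'"
    and t: "t \<in> S" "(a, b) \<in> t" "(a', b') \<in> t"
  shows "card {c. (a, c) \<in> R \<and> (c, b) \<in> R'} = card {c. (a', c) \<in> R \<and> (c, b') \<in> R'}"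
proof -
  obtain S1 S2 where S1: "S1 \<subseteq> S" "R = \<Union>S1" and S2: "S2 \<subseteq> S" "R' = \<Union>S2"
    using R R' by (auto simp: cc_relation_def)
  have "card {c. (x, c) \<in> R \<and> (c, y) \<in> R'} = (\<Sum>(r, s)\<in>S1 \<times> S2. card {c. (x, c) \<in> r \<and> (c, y) \<in> s})"
    for x y
  proof -
    let ?N = "\<lambda>(r, s). {c. (x, c) \<in> r \<and> (c, y) \<in> s}"
    have "{c. (x, c) \<in> R \<and> (c, y) \<in> R'} = (\<Union>p\<in>S1 \<times> S2. ?N p)" using S1 S2 by auto
    also have "card \<dots> = (\<Sum>p\<in>S1 \<times> S2. card (?N p))"
    proof (intro card_UN_disjoint ballI impI)
      show "finite (S1 \<times> S2)" using S1 S2 finite_basic finite_subset by blast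
      show "finite (?N p)" if "p \<in> S1 \<times> S2" for p
        by (rule finite_subset[OF _ finite_points]) (use that S1 basic_subset in auto)
      fix p q assume pq: "p \<in> S1 \<times> S2" "q \<in> S1 \<times> S2" "p \<noteq> q"
      show "?N p \<inter> ?N q = {}"
      proof (rule equals0I)
        fix c assume "c \<in> ?N p \<inter> ?N q"
        then have "(x, c) \<in> fst p" "(x, c) \<in> fst q" "(c, y) \<in> snd p" "(c, y) \<in> snd q"
          by (auto simp: case_prod_unfold)
        moreover have "fst p \<in> S" "fst q \<in> S" "snd p \<in> S" "snd q \<in> S" using pq(1,2) S1 S2 by auto
        ultimately show False using pq(3) basic_unique prod_eqI by metis
      qed
    qed
    finally show ?thesis by (simp add: case_prod_unfold)
  qed
  moreover have "card {c. (a, c) \<in> r \<and> (c, b) \<in> s} = card {c. (a', c) \<in> r \<and> (c, b') \<in> s}"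
    if "r \<in> S1" "s \<in> S2" for r s
    using that S1 S2 basic_card t by blast
  ultimately show ?thesis by (auto intro: sum.cong)
qed

lemma relation_count:
  assumes "cc_relation S R" "cc_relation S R'"
  shows "cc_relation S {(a, b) \<in> \<Omega> \<times> \<Omega>. P (card {c. (a, c) \<in> R \<and> (c, b) \<in> R'})}"
proof (rule relationI)
  fix t p q
  assume t: "t \<in> S" "p \<in> t" "q \<in> t"
    and p: "p \<in> {(a, b) \<in> \<Omega> \<times> \<Omega>. P (card {c. (a, c) \<in> R \<and> (c, b) \<in> R'})}"
  obtain a b a' b' where "p = (a, b)" "q = (a', b')" by fastforce
  then show "q \<in> {(a, b) \<in> \<Omega> \<times> \<Omega>. P (card {c. (a, c) \<in> R \<and> (c, b) \<in> R'})}"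
    using relation_card[OF assms, of t a b a' b'] basic_subset t p by auto
qed auto

lemma relation_relcomp:
  assumes "cc_relation S R" "cc_relation S R'"
  shows "cc_relation S (R O R')"
proof -
  have "finite {c. (a, c) \<in> R \<and> (c, b) \<in> R'}" for a b
    by (rule finite_subset[OF _ relation_finite_Image[OF assms(1), of "{a}"]]) auto
  then have "R O R' = {(a, b) \<in> \<Omega> \<times> \<Omega>. card {c. (a, c) \<in> R \<and> (c, b) \<in> R'} \<noteq> 0}"
    using relation_subset[OF assms(1)] relation_subset[OF assms(2)]
    by (auto simp: relcomp_unfold card_eq_0_iff)
  then show ?thesis using relation_count[OF assms, of "\<lambda>n. n \<noteq> 0"] by simp
qed

lemma set_subset: "cc_set S A \<Longrightarrow> A \<subseteq> \<Omega>"
  using relation_subset unfolding cc_set_def by blast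

lemma set_finite: "cc_set S A \<Longrightarrow> finite A"
  using set_subset finite_points finite_subset by blast

lemma set_fiber: "Id_on A \<in> S \<Longrightarrow> cc_set S A"
  unfolding cc_set_def by (rule cc_relation_basic)

lemma set_full: "cc_set S \<Omega>"
  unfolding cc_set_def by (rule relation_Id)

lemma set_empty: "cc_set S {}"
  using relation_empty by (simp add: cc_set_def)

lemma set_Un: "cc_set S A \<Longrightarrow> cc_set S B \<Longrightarrow> cc_set S (A \<union> B)"
  and set_Int: "cc_set S A \<Longrightarrow> cc_set S B \<Longrightarrow> cc_set S (A \<inter> B)"
  and set_Diff: "cc_set S A \<Longrightarrow> cc_set S B \<Longrightarrow> cc_set S (A - B)"
proof -
  have "Id_on (A \<union> B) = Id_on A \<union> Id_on B" "Id_on (A \<inter> B) = Id_on A \<inter> Id_on B"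
    "Id_on (A - B) = Id_on A - Id_on B" by auto
  then show "cc_set S A \<Longrightarrow> cc_set S B \<Longrightarrow> cc_set S (A \<union> B)"
    "cc_set S A \<Longrightarrow> cc_set S B \<Longrightarrow> cc_set S (A \<inter> B)"
    "cc_set S A \<Longrightarrow> cc_set S B \<Longrightarrow> cc_set S (A - B)"
    using relation_Un relation_Int relation_Diff unfolding cc_set_def by simp_all
qed

lemma Id_on_loops: "cc_relation S R \<Longrightarrow> Id_on {x. (x, x) \<in> R} = R \<inter> Id_on \<Omega>"
  using relation_subset by auto

lemma set_loops: "cc_relation S R \<Longrightarrow> cc_set S {x. (x, x) \<in> R}"
  unfolding cc_set_def by (simp add: Id_on_loops relation_Int relation_Id)

lemma set_Domain:
  assumes "cc_relation S R"
  shows "cc_set S (Domain R)"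
proof -
  have "Id_on (Domain R) = Id_on \<Omega> \<inter> (R O R\<inverse>)" using relation_subset[OF assms] by auto
  then show ?thesis
    using assms
    by (simp add: cc_set_def relation_Int relation_Id relation_relcomp relation_converse)
qed

lemma set_Range: "cc_relation S R \<Longrightarrow> cc_set S (Range R)"
  using set_Domain[of "R\<inverse>"] relation_converse by simp

lemma set_degree:
  assumes "cc_relation S R"
  shows "cc_set S {a \<in> \<Omega>. P (card (R `` {a}))}"
proof -
  have "Id_on {a \<in> \<Omega>. P (card (R `` {a}))}
      = Id_on \<Omega> \<inter> {(a, b) \<in> \<Omega> \<times> \<Omega>. P (card {c. (a, c) \<in> R \<and> (c, b) \<in> R\<inverse>})}"
    by (auto simp: Image_def Id_on_def)
  then show ?thesis
    unfolding cc_set_def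
    using relation_Int[OF relation_Id relation_count[OF assms relation_converse[OF assms]]]
    by simp
qed

lemma relation_restrict:
  assumes "cc_set S A" "cc_relation S R" "cc_set S B"
  shows "cc_relation S (R \<inter> A \<times> B)"
proof -
  have "R \<inter> A \<times> B = Id_on A O R O Id_on B" by auto
  then show ?thesis using relation_relcomp assms unfolding cc_set_def by metis
qed

lemma relation_Times: "cc_set S A \<Longrightarrow> cc_set S B \<Longrightarrow> cc_relation S (A \<times> B)"
  using relation_restrict[OF _ relation_full, of A B] set_subset
  by (simp add: Int_absorb1 Sigma_mono)

lemma unions_of_fibers_iff: "unions_of_fibers S PP \<longleftrightarrow> (\<forall>P\<in>PP. cc_set S P)"
proof -
  have "(\<exists>F \<subseteq> fibers S. P = \<Union>F) \<longleftrightarrow> cc_set S P" for P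
  proof
    assume "\<exists>F \<subseteq> fibers S. P = \<Union>F"
    then obtain F where "F \<subseteq> fibers S" "P = \<Union>F" by blast
    then have "Id_on P = \<Union>(Id_on ` F)" "Id_on ` F \<subseteq> S" by (auto simp: fibers_def)
    then show "cc_set S P" unfolding cc_set_def cc_relation_def by blast
  next
    assume "cc_set S P"
    then obtain S0 where S0: "S0 \<subseteq> S" "Id_on P = \<Union>S0" unfolding cc_set_def cc_relation_def by blast
    have "Id_on (Domain s) = s" if "s \<in> S0" for s
    proof -
      have "s \<subseteq> Id_on P" using S0 that by auto
      then show ?thesis by (auto simp: Id_on_def)
    qed
    then have "Domain ` S0 \<subseteq> fibers S" using S0 by (auto simp: fibers_def)
    moreover have "P = \<Union>(Domain ` S0)"
    proof -
      have "P = Domain (Id_on P)" by auto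
      also have "\<dots> = \<Union>(Domain ` S0)" unfolding S0(2) by auto
      finally show ?thesis .
    qed
    ultimately show "\<exists>F \<subseteq> fibers S. P = \<Union>F" by blast
  qed
  then show ?thesis by (simp add: unions_of_fibers_def)
qed

lemma complete_iff: "cc_complete S \<longleftrightarrow> (\<forall>a\<in>\<Omega>. cc_set S {a})"
proof (intro iffI ballI)
  fix a assume "cc_complete S" "a \<in> \<Omega>"
  then obtain s where "s \<in> S" "(a, a) \<in> s" using ex_basic by blast
  then have "s = Id_on {a}" using \<open>cc_complete S\<close> unfolding cc_complete_def by fastforce
  then show "cc_set S {a}" using cc_relation_basic \<open>s \<in> S\<close> unfolding cc_set_def by metis
next
  assume singletons: "\<forall>a\<in>\<Omega>. cc_set S {a}"
  show "cc_complete S"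
    unfolding cc_complete_def
  proof
    fix s assume s: "s \<in> S"
    then obtain a b where ab: "(a, b) \<in> s" using basic_nonempty by fastforce
    then have "cc_relation S ({a} \<times> {b})"
      using singletons relation_Times basic_subset s by blast
    then have "s \<subseteq> {(a, b)}" using relation_saturated[OF _ s ab] by fastforce
    then show "\<exists>x. s = {x}" using ab by blast
  qed
qed

lemma complete_if_trivial: "\<Omega> \<subseteq> {p} \<Longrightarrow> cc_complete S"
  unfolding complete_iff using set_full by (metis empty_iff singleton_iff subset_singleton_iff)

end

lemma fission_coherent: "fission \<Omega> S Z \<Longrightarrow> coherent \<Omega> Z"
  by unfold_locales (simp add: fission_def)

lemma fission_set: "fission \<Omega> S Z \<Longrightarrow> cc_set S A \<Longrightarrow> cc_set Z A"
  by (simp add: fission_def cc_set_def)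

section \<open>Generalized bases\<close>

lemma coherent_discrete: "finite \<Omega> \<Longrightarrow> coherent_config \<Omega> ((\<lambda>p. {p}) ` (\<Omega> \<times> \<Omega>))"
proof -
  let ?S = "(\<lambda>p. {p}) ` (\<Omega> \<times> \<Omega>)"
  have "\<exists>S0\<subseteq>?S. \<Union>S0 = Id_on \<Omega>"
    by (rule exI[of _ "(\<lambda>p. {p}) ` Id_on \<Omega>"]) auto
  moreover have "\<forall>s\<in>?S. s\<inverse> \<in> ?S" by auto
  ultimately show "finite \<Omega> \<Longrightarrow> coherent_config \<Omega> ?S"
    using partition_on_singletons unfolding coherent_config_def by auto
qed

lemma is_Pi_fission_discrete:
  assumes "finite \<Omega>" "S \<subseteq> Pow (\<Omega> \<times> \<Omega>)" "PP \<subseteq> Pow \<Omega>"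
    and complete: "\<And>Z. fission \<Omega> S Z \<Longrightarrow> \<forall>P\<in>PP. cc_set Z P \<Longrightarrow> cc_complete Z"
  shows "is_Pi_fission \<Omega> S PP ((\<lambda>p. {p}) ` (\<Omega> \<times> \<Omega>))" (is "is_Pi_fission _ _ _ ?D")
proof -
  interpret D: coherent \<Omega> ?D using coherent_discrete[OF assms(1)] by unfold_locales
  have relation_iff: "cc_relation ?D r \<longleftrightarrow> r \<subseteq> \<Omega> \<times> \<Omega>" for r
    using D.relation_subset by (auto intro!: D.relationI)
  show ?thesis
    unfolding is_Pi_fission_def
  proof (intro conjI allI impI)
    show "fission \<Omega> S ?D"
      unfolding fission_def relation_iff using D.coherent assms(2) unfolding cc_relation_def
      by blast
    show "unions_of_fibers ?D PP"
      unfolding D.unions_of_fibers_iff cc_set_def relation_iff using assms(3) by auto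
    fix Z r assume Z: "fission \<Omega> S Z \<and> unions_of_fibers Z PP" and "cc_relation ?D r"
    interpret Z: coherent \<Omega> Z using Z fission_coherent by blast
    have "cc_complete Z" using complete Z Z.unions_of_fibers_iff by blast
    then have "q = p" if "s \<in> Z" "p \<in> s" "q \<in> s" for s p q
      using that unfolding cc_complete_def by fastforce
    then show "cc_relation Z r"
      using \<open>cc_relation ?D r\<close> unfolding relation_iff by (metis Z.relationI)
  qed
qed

lemma generalized_base_iff:
  assumes "finite \<Omega>" "S \<subseteq> Pow (\<Omega> \<times> \<Omega>)"
  shows "generalized_base \<Omega> S PP \<longleftrightarrow> PP \<subseteq> Pow \<Omega> \<and>
    (\<forall>Z. fission \<Omega> S Z \<longrightarrow> (\<forall>P\<in>PP. cc_set Z P) \<longrightarrow> cc_complete Z)"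
proof (intro iffI conjI allI impI)
  fix Z assume base: "generalized_base \<Omega> S PP" and Z: "fission \<Omega> S Z" "\<forall>P\<in>PP. cc_set Z P"
  obtain S' where S': "is_Pi_fission \<Omega> S PP S'" "cc_complete S'"
    using base unfolding generalized_base_def by blast
  interpret S': coherent \<Omega> S' using S' fission_coherent by (auto simp: is_Pi_fission_def)
  interpret Z: coherent \<Omega> Z using Z(1) by (rule fission_coherent)
  have "cc_relation S' r \<Longrightarrow> cc_relation Z r" for r
    using S'(1) Z Z.unions_of_fibers_iff unfolding is_Pi_fission_def by blast
  then show "cc_complete Z" using S'(2) unfolding Z.complete_iff S'.complete_iff cc_set_def by blast
next
  assume "PP \<subseteq> Pow \<Omega> \<and> (\<forall>Z. fission \<Omega> S Z \<longrightarrow> (\<forall>P\<in>PP. cc_set Z P) \<longrightarrow> cc_complete Z)"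
  then show "generalized_base \<Omega> S PP"
    using is_Pi_fission_discrete[OF assms, of PP] unfolding generalized_base_def
    by (auto intro!: exI[of _ "(\<lambda>p. {p}) ` (\<Omega> \<times> \<Omega>)"] simp: cc_complete_def)
qed (simp add: generalized_base_def)

lemma generalized_base_singletons:
  assumes "finite \<Omega>" "S \<subseteq> Pow (\<Omega> \<times> \<Omega>)"
  shows "generalized_base \<Omega> S ((\<lambda>x. {x}) ` \<Omega>)"
  unfolding generalized_base_iff[OF assms]
proof (intro conjI allI impI)
  fix Z assume Z: "fission \<Omega> S Z" "\<forall>P\<in>(\<lambda>x. {x}) ` \<Omega>. cc_set Z P"
  interpret Z: coherent \<Omega> Z using Z(1) by (rule fission_coherent)
  show "cc_complete Z" using Z(2) unfolding Z.complete_iff by blast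
qed auto

lemma gb_attained:
  assumes "finite \<Omega>" "S \<subseteq> Pow (\<Omega> \<times> \<Omega>)"
  obtains PP where "generalized_base \<Omega> S PP" "card PP = gb \<Omega> S" "finite PP"
proof -
  have "\<exists>n PP. generalized_base \<Omega> S PP \<and> card PP = n"
    using generalized_base_singletons[OF assms] by blast
  from LeastI_ex[OF this] obtain PP where "generalized_base \<Omega> S PP" "card PP = gb \<Omega> S"
    unfolding gb_def by blast
  moreover from this(1) have "finite PP"
    using assms(1) finite_subset unfolding generalized_base_def by blast
  ultimately show ?thesis by (rule that)
qed

lemma gb_le: "generalized_base \<Omega> S PP \<Longrightarrow> gb \<Omega> S \<le> card PP"
  unfolding gb_def by (rule Least_le) blast

lemma gb_trivial:
  assumes "finite \<Omega>" "S \<subseteq> Pow (\<Omega> \<times> \<Omega>)" "\<Omega> \<subseteq> {p}"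
  shows "gb \<Omega> S = 0"
proof -
  have "generalized_base \<Omega> S {}"
    unfolding generalized_base_iff[OF assms(1,2)]
    using coherent.complete_if_trivial[OF fission_coherent assms(3)] by blast
  from gb_le[OF this] show ?thesis by simp
qed

lemma bnum_attained:
  assumes "finite \<Omega>" "S \<subseteq> Pow (\<Omega> \<times> \<Omega>)"
  obtains B where "cc_base \<Omega> S B" "card B = bnum \<Omega> S"
proof -
  have "\<exists>n B. cc_base \<Omega> S B \<and> card B = n"
    using generalized_base_singletons[OF assms] unfolding cc_base_def by blast
  from LeastI_ex[OF this] show ?thesis using that unfolding bnum_def by blast
qed

lemma bnum_le: "cc_base \<Omega> S B \<Longrightarrow> bnum \<Omega> S \<le> card B"
  unfolding bnum_def by (rule Least_le) blast

context coherent
begin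

lemma generalized_base_Diff_sets:
  assumes "generalized_base \<Omega> S PP"
  shows "generalized_base \<Omega> S (PP - {P. cc_set S P})"
  unfolding generalized_base_iff[OF finite_points basic_subset]
proof (intro conjI allI impI)
  show "PP - {P. cc_set S P} \<subseteq> Pow \<Omega>" using assms by (auto simp: generalized_base_def)
  fix Z assume Z: "fission \<Omega> S Z" "\<forall>P\<in>PP - {P. cc_set S P}. cc_set Z P"
  then have "\<forall>P\<in>PP. cc_set Z P" using fission_set by blast
  then show "cc_complete Z"
    using assms Z(1) unfolding generalized_base_iff[OF finite_points basic_subset] by blast
qed

lemma complete_iff_generalized_base_empty: "cc_complete S \<longleftrightarrow> generalized_base \<Omega> S {}"
proof
  assume complete: "cc_complete S"
  have "cc_complete Z" if Z: "fission \<Omega> S Z" for Z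
  proof -
    interpret Z: coherent \<Omega> Z using Z by (rule fission_coherent)
    show ?thesis using complete fission_set[OF Z] unfolding complete_iff Z.complete_iff by blast
  qed
  then show "generalized_base \<Omega> S {}"
    unfolding generalized_base_iff[OF finite_points basic_subset] by blast
next
  assume "generalized_base \<Omega> S {}"
  then show "cc_complete S"
    using coherent unfolding generalized_base_iff[OF finite_points basic_subset] fission_def
    by blast
qed

lemma minimal_base_not_set:
  assumes "cc_base \<Omega> S A" "card A = bnum \<Omega> S" "x \<in> A"
  shows "\<not> cc_set S {x}"
proof
  assume "cc_set S {x}"
  have "generalized_base \<Omega> S ((\<lambda>x. {x}) ` A - {P. cc_set S P})"
    using assms(1) generalized_base_Diff_sets unfolding cc_base_def by blast
  also have "(\<lambda>x. {x}) ` A - {P. cc_set S P} = (\<lambda>x. {x}) ` {a \<in> A. \<not> cc_set S {a}}" by auto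
  finally have "cc_base \<Omega> S {a \<in> A. \<not> cc_set S {a}}"
    using assms(1) by (auto simp: cc_base_def)
  then have "card A \<le> card {a \<in> A. \<not> cc_set S {a}}" unfolding assms(2) by (rule bnum_le)
  moreover have "finite A" using assms(1) finite_points finite_subset unfolding cc_base_def by blast
  then have "card {a \<in> A. \<not> cc_set S {a}} < card A"
    by (rule psubset_card_mono) (use assms(3) \<open>cc_set S {x}\<close> in blast)
  ultimately show False by simp
qed

end

section \<open>Coherent configurations from algebras of relations\<close>

lemma finite_algebra_partition:
  assumes "finite U" "algebra U \<A>"
  obtains P where "partition_on U P" "\<And>A. A \<in> \<A> \<longleftrightarrow> (\<exists>Q\<subseteq>P. A = \<Union>Q)"
proof -
  interpret algebra U \<A> by (rule assms(2))
  define r where "r = {(x, y). x \<in> U \<and> y \<in> U \<and> (\<forall>A\<in>\<A>. x \<in> A \<longleftrightarrow> y \<in> A)}"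
  have fin: "finite \<A>" using space_closed \<open>finite U\<close> finite_subset by blast
  have equiv: "equiv U r"
    by (rule equivI) (auto simp: r_def refl_on_def sym_def trans_def)
  have in_algebra: "r `` {x} \<in> \<A>" if x: "x \<in> U" for x
  proof -
    have "r `` {x} = (\<Inter>A\<in>{A \<in> \<A>. x \<in> A}. A)"
    proof (intro equalityI subsetI)
      fix y assume y: "y \<in> (\<Inter>A\<in>{A \<in> \<A>. x \<in> A}. A)"
      then have "y \<in> U" using top x by blast
      moreover have "x \<in> A \<longleftrightarrow> y \<in> A" if "A \<in> \<A>" for A
        using y compl_sets[OF that] that x by auto
      ultimately show "y \<in> r `` {x}" using x by (simp add: r_def)
    qed (auto simp: r_def)
    also have "\<dots> \<in> \<A>" by (rule finite_INT) (use fin top x in auto)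
    finally show ?thesis .
  qed
  have classes: "U // r \<subseteq> \<A>" using in_algebra by (auto elim: quotientE)
  show ?thesis
  proof (rule that[of "U // r"], rule partition_on_quotient[OF equiv], intro iffI)
    fix A assume A: "A \<in> \<A>"
    then have "A = (\<Union>x\<in>A. r `` {x})" using sets_into_space by (auto simp: r_def)
    then show "\<exists>Q\<subseteq>U // r. A = \<Union>Q"
      using sets_into_space[OF A]
      by (intro exI[of _ "(\<lambda>x. r `` {x}) ` A"]) (auto simp: quotient_def)
  next
    fix A assume "\<exists>Q\<subseteq>U // r. A = \<Union>Q"
    then show "A \<in> \<A>" using finite_Union classes fin finite_subset by (metis subset_trans)
  qed
qed

lemma partition_on_Union_subset:
  assumes "partition_on U P" "s \<in> P" "Q \<subseteq> P" "\<Union>Q \<subseteq> s"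
  shows "\<Union>Q = {} \<or> \<Union>Q = s"
proof -
  have "t = s" if "t \<in> Q" for t
  proof -
    have "t \<noteq> {}" "t \<subseteq> s" "t \<in> P" using that assms(3,4) partition_onD3[OF assms(1)] by auto
    then show ?thesis using partition_onD2[OF assms(1)] \<open>s \<in> P\<close> unfolding disjoint_def by blast
  qed
  then show ?thesis by blast
qed

lemma coherent_of_algebra:
  fixes \<R> :: "'a rel set"
  assumes fin: "finite \<Omega>" and algebra: "algebra (\<Omega> \<times> \<Omega>) \<R>" and Id: "Id_on \<Omega> \<in> \<R>"
    and converse: "\<And>R. R \<in> \<R> \<Longrightarrow> R\<inverse> \<in> \<R>"
    and count: "\<And>R R' n. R \<in> \<R> \<Longrightarrow> (\<And>Q. Q \<in> \<R> \<Longrightarrow> Q \<subseteq> R \<Longrightarrow> Q = {} \<or> Q = R) \<Longrightarrow> R' \<in> \<R> \<Longrightarrow>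
      {(x, y) \<in> \<Omega> \<times> \<Omega>. card {z. (x, z) \<in> R \<and> (z, y) \<in> R'} = n} \<in> \<R>"
  obtains S where "coherent_config \<Omega> S" "\<And>R. cc_relation S R \<longleftrightarrow> R \<in> \<R>"
proof -
  interpret algebra "\<Omega> \<times> \<Omega>" \<R> by (rule algebra)
  obtain S where S: "partition_on (\<Omega> \<times> \<Omega>) S" "\<And>R. R \<in> \<R> \<longleftrightarrow> (\<exists>S0\<subseteq>S. R = \<Union>S0)"
    using finite_algebra_partition[OF _ algebra] fin by (metis finite_SigmaI)
  have basic: "s \<in> \<R>" if "s \<in> S" for s
    unfolding S(2) using that by (intro exI[of _ "{s}"]) simp
  have minimal: "Q = {} \<or> Q = s" if "s \<in> S" "Q \<in> \<R>" "Q \<subseteq> s" for s Q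
    using that partition_on_Union_subset[OF S(1)] unfolding S(2) by blast
  have "coherent_config \<Omega> S"
    unfolding coherent_config_def
  proof (intro conjI ballI allI impI)
    show "\<exists>S0\<subseteq>S. \<Union>S0 = Id_on \<Omega>" using Id S(2) by metis
    fix s assume s: "s \<in> S"
    obtain S0 where S0: "S0 \<subseteq> S" "s\<inverse> = \<Union>S0" using converse[OF basic[OF s]] unfolding S(2) by blast
    have "s \<noteq> {}" using s partition_onD3[OF S(1)] by auto
    then obtain t where t: "t \<in> S" "t \<subseteq> s\<inverse>" using S0 by fastforce
    then have "t \<noteq> {}" "t\<inverse> \<subseteq> s" using partition_onD3[OF S(1)] by auto
    then have "t\<inverse> \<noteq> {}" by fastforce
    then have "t\<inverse> = s" using minimal[OF s] converse basic t(1) \<open>t\<inverse> \<subseteq> s\<close> by blast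
    then show "s\<inverse> \<in> S" using t(1) by auto
  next
    fix r s t a b a' b'
    assume r: "r \<in> S" and s: "s \<in> S" and t: "t \<in> S" "(a, b) \<in> t" "(a', b') \<in> t"
    let ?N = "\<lambda>x y. {z. (x, z) \<in> r \<and> (z, y) \<in> s}"
    let ?C = "{(x, y) \<in> \<Omega> \<times> \<Omega>. card (?N x y) = card (?N a b)}"
    have "?C \<in> \<R>" by (rule count) (use basic r s minimal in auto)
    then have "t - ?C \<in> \<R>" using basic t(1) by blast
    moreover have "(a, b) \<in> ?C" using partition_onD1[OF S(1)] t by auto
    ultimately have "t \<subseteq> ?C" using minimal[OF t(1), of "t - ?C"] t(2) by auto
    then show "card (?N a b) = card (?N a' b')" using t(3) by auto
  qed (use fin S(1) in auto)
  then show ?thesis using that S(2) unfolding cc_relation_def by blast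
qed

definition pullback :: "'a rel \<Rightarrow> ('a \<Rightarrow> 'b) \<Rightarrow> 'b rel \<Rightarrow> 'a rel" where
  "pullback M \<pi> R = {(a, b) \<in> M. (\<pi> a, \<pi> b) \<in> R}"

text \<open>\<open>\<pi>\<close> identifies each class of \<open>M\<close> with \<open>X\<close>, up to multiplicities that depend on the point of \<open>X\<close>
  only. Weighted by them, the intersection numbers on \<open>X\<close> are intersection numbers of \<open>S\<close>.\<close>

locale coherent_quotient = coherent +
  fixes M :: "'a rel" and \<pi> :: "'a \<Rightarrow> 'b" and X :: "'b set"
  assumes relation_M: "cc_relation S M"
    and sym_M: "sym M" and trans_M: "trans M" and nonempty_M: "M \<noteq> {}"
    and onto: "\<And>a. a \<in> Domain M \<Longrightarrow> \<pi> ` (M `` {a}) = X"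
    and relation_kernel: "cc_relation S (pullback M \<pi> Id)"
    and card_kernel: "\<And>a b. a \<in> Domain M \<Longrightarrow> b \<in> Domain M \<Longrightarrow> \<pi> a = \<pi> b \<Longrightarrow>
      card (pullback M \<pi> Id `` {a}) = card (pullback M \<pi> Id `` {b})"
begin

abbreviation lift :: "'b rel \<Rightarrow> 'a rel" where
  "lift \<equiv> pullback M \<pi>"

lemma M_sym: "(a, b) \<in> M \<Longrightarrow> (b, a) \<in> M"
  and M_trans: "(a, b) \<in> M \<Longrightarrow> (b, c) \<in> M \<Longrightarrow> (a, c) \<in> M"
  using sym_M trans_M by (blast dest: symD transD)+

lemma M_class: "(a, b) \<in> M \<Longrightarrow> (a, c) \<in> M \<longleftrightarrow> (b, c) \<in> M"
  using M_sym M_trans by metis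

lemma lift_in_X: "(a, b) \<in> M \<Longrightarrow> \<pi> a \<in> X \<and> \<pi> b \<in> X"
  using onto M_sym by (metis DomainI ImageI image_eqI insertI1)

lemma finite_X: "finite X"
proof -
  obtain a where a: "a \<in> Domain M" using nonempty_M by auto
  then show ?thesis using onto[OF a] relation_finite_Image[OF relation_M] by (metis finite_imageI)
qed

lemma ex_lift:
  assumes "x \<in> X" "y \<in> X"
  obtains a b where "(a, b) \<in> M" "\<pi> a = x" "\<pi> b = y"
proof -
  obtain c where "c \<in> Domain M" using nonempty_M by auto
  then have "x \<in> \<pi> ` (M `` {c})" "y \<in> \<pi> ` (M `` {c})" using onto assms by simp_all
  then obtain a b where "(c, a) \<in> M" "(c, b) \<in> M" "\<pi> a = x" "\<pi> b = y" by auto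
  then show ?thesis using that M_class by blast
qed

lemma ex_multiplicity:
  obtains w where "\<And>a. a \<in> Domain M \<Longrightarrow> card (lift Id `` {a}) = w (\<pi> a)" "\<And>x. x \<in> X \<Longrightarrow> w x > 0"
proof -
  define w where "w x = card (lift Id `` {SOME a. a \<in> Domain M \<and> \<pi> a = x})" for x
  have w: "card (lift Id `` {a}) = w (\<pi> a)" if "a \<in> Domain M" for a
    unfolding w_def using card_kernel[OF that] someI[of "\<lambda>c. c \<in> Domain M \<and> \<pi> c = \<pi> a" a] that
    by metis
  moreover have "w x > 0" if x: "x \<in> X" for x
  proof -
    obtain a where a: "(a, a) \<in> M" "\<pi> a = x"
      using ex_lift[OF x x] M_sym M_trans by metis
    have "finite (lift Id `` {a})" by (rule relation_finite_Image[OF relation_kernel])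
    moreover have "a \<in> lift Id `` {a}" using a by (simp add: pullback_def)
    ultimately show ?thesis using w[of a] a by (metis DomainI card_gt_0_iff empty_iff)
  qed
  ultimately show ?thesis by (rule that)
qed

lemma card_lift:
  assumes ab: "(a, b) \<in> M" and "R \<subseteq> X \<times> X"
    and n: "\<And>c. (a, c) \<in> lift R \<Longrightarrow> card (lift Id `` {c}) = n"
  shows "card {c. (a, c) \<in> lift R \<and> (c, b) \<in> lift R'} = n * card {z. (\<pi> a, z) \<in> R \<and> (z, \<pi> b) \<in> R'}"
proof -
  let ?N = "{z. (\<pi> a, z) \<in> R \<and> (z, \<pi> b) \<in> R'}"
  have fiber: "{c. (a, c) \<in> M \<and> \<pi> c = z} = lift Id `` {d}" if "(a, d) \<in> M" "\<pi> d = z" for d z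
    using that M_class[OF that(1)] by (auto simp: pullback_def)
  have "(c, b) \<in> M" if "(a, c) \<in> M" for c using ab that M_class by blast
  then have "{c. (a, c) \<in> lift R \<and> (c, b) \<in> lift R'} = (\<Union>z\<in>?N. {c. (a, c) \<in> M \<and> \<pi> c = z})"
    by (auto simp: pullback_def)
  also have "card \<dots> = (\<Sum>z\<in>?N. card {c. (a, c) \<in> M \<and> \<pi> c = z})"
  proof (rule card_UN_disjoint)
    show "finite ?N" by (rule finite_subset[OF _ finite_X]) (use assms(2) in auto)
    show "\<forall>z\<in>?N. finite {c. (a, c) \<in> M \<and> \<pi> c = z}"
      using relation_subset[OF relation_M] by (auto intro: finite_subset[OF _ finite_points])
  qed auto
  also have "\<dots> = (\<Sum>z\<in>?N. n)"
  proof (rule sum.cong)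
    fix z assume z: "z \<in> ?N"
    then have "z \<in> X" using assms(2) by auto
    then obtain d where "(a, d) \<in> M" "\<pi> d = z"
      using onto[of a] ab by (metis DomainI Image_singleton_iff imageE)
    then show "card {c. (a, c) \<in> M \<and> \<pi> c = z} = n" using fiber n[of d] z by (simp add: pullback_def)
  qed simp
  finally show ?thesis by simp
qed

lemma relation_lift_count:
  assumes R: "cc_relation S (lift R)" "R \<subseteq> X \<times> X" and R': "cc_relation S (lift R')"
    and minimal: "\<And>Q. Q \<subseteq> R \<Longrightarrow> cc_relation S (lift Q) \<Longrightarrow> Q = {} \<or> Q = R"
  shows "cc_relation S (lift {(x, y) \<in> X \<times> X. card {z. (x, z) \<in> R \<and> (z, y) \<in> R'} = n})"
proof (cases "R = {}")
  case True
  have "lift (X \<times> X) = M" using lift_in_X by (auto simp: pullback_def)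
  moreover have "lift {} = {}" by (simp add: pullback_def)
  moreover have "{(x, y) \<in> X \<times> X. card {z. (x, z) \<in> R \<and> (z, y) \<in> R'} = n}
      = (if n = 0 then X \<times> X else {})"
    using True by auto
  ultimately show ?thesis using relation_M relation_empty by simp
next
  case False
  then obtain x z where xz: "(x, z) \<in> R" by auto
  obtain w where w: "\<And>a. a \<in> Domain M \<Longrightarrow> card (lift Id `` {a}) = w (\<pi> a)" "\<And>x. x \<in> X \<Longrightarrow> w x > 0"
    using ex_multiplicity by blast
  have Domain_M: "b \<in> Domain M" if "(a, b) \<in> M" for a b using M_sym[OF that] by blast
  let ?Q = "{(x, y) \<in> R. w y = w z}"
  have "lift ?Q = lift R \<inter> \<Omega> \<times> {b \<in> \<Omega>. card (lift Id `` {b}) = w z}"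
    using w(1) Domain_M relation_subset[OF relation_M] unfolding pullback_def by auto
  then have "cc_relation S (lift ?Q)"
    using relation_restrict[OF set_full R(1) set_degree[OF relation_kernel]] by simp
  then have "?Q = R" using minimal[of ?Q] xz by auto
  then have weight: "card (lift Id `` {c}) = w z" if "(a, c) \<in> lift R" for a c
    using that w(1) Domain_M unfolding pullback_def by fastforce
  have "w z > 0" using w(2) R(2) xz by auto
  then have "lift {(x, y) \<in> X \<times> X. card {z. (x, z) \<in> R \<and> (z, y) \<in> R'} = n}
      = M \<inter> {(a, b) \<in> \<Omega> \<times> \<Omega>. card {c. (a, c) \<in> lift R \<and> (c, b) \<in> lift R'} = w z * n}"
    using card_lift[OF _ R(2) weight] lift_in_X relation_subset[OF relation_M]
    unfolding pullback_def[of M \<pi> "{(x, y) \<in> X \<times> X. _ x y}"] by auto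
  then show ?thesis using relation_Int[OF relation_M relation_count[OF R(1) R']] by simp
qed

lemma ex_quotient:
  obtains S' where "coherent_config X S'"
    "\<And>R. cc_relation S' R \<longleftrightarrow> R \<subseteq> X \<times> X \<and> cc_relation S (lift R)"
proof -
  define \<R> where "\<R> = {R. R \<subseteq> X \<times> X \<and> cc_relation S (lift R)}"
  obtain S' where "coherent_config X S'" "\<And>R. cc_relation S' R \<longleftrightarrow> R \<in> \<R>"
  proof (rule coherent_of_algebra[OF finite_X, of \<R>])
    show "algebra (X \<times> X) \<R>"
      unfolding algebra_iff_Int
    proof (intro conjI ballI)
      show "{} \<in> \<R>" using relation_empty by (simp add: \<R>_def pullback_def)
      fix R assume R: "R \<in> \<R>"
      have "lift (X \<times> X - R) = M - lift R" using lift_in_X by (auto simp: pullback_def)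
      then show "X \<times> X - R \<in> \<R>" using R relation_Diff[OF relation_M] by (auto simp: \<R>_def)
      fix R' assume R': "R' \<in> \<R>"
      have "lift (R \<inter> R') = lift R \<inter> lift R'" by (auto simp: pullback_def)
      then show "R \<inter> R' \<in> \<R>" using R R' relation_Int by (auto simp: \<R>_def)
    qed (auto simp: \<R>_def)
    have "lift (Id_on X) = lift Id" using lift_in_X by (auto simp: pullback_def)
    then show "Id_on X \<in> \<R>" using relation_kernel by (auto simp: \<R>_def)
    fix R assume R: "R \<in> \<R>"
    have "lift (R\<inverse>) = (lift R)\<inverse>" by (auto simp: pullback_def intro: M_sym)
    then show "R\<inverse> \<in> \<R>" using R relation_converse by (auto simp: \<R>_def)
    fix R' n assume R': "R' \<in> \<R>" and minimal: "\<And>Q. Q \<in> \<R> \<Longrightarrow> Q \<subseteq> R \<Longrightarrow> Q = {} \<or> Q = R"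
    have "cc_relation S (lift {(x, y) \<in> X \<times> X. card {z. (x, z) \<in> R \<and> (z, y) \<in> R'} = n})"
    proof (rule relation_lift_count)
      fix Q assume "Q \<subseteq> R" "cc_relation S (lift Q)"
      then show "Q = {} \<or> Q = R" using R minimal[of Q] by (auto simp: \<R>_def)
    qed (use R R' in \<open>auto simp: \<R>_def\<close>)
    then show "{(x, y) \<in> X \<times> X. card {z. (x, z) \<in> R \<and> (z, y) \<in> R'} = n} \<in> \<R>"
      by (auto simp: \<R>_def)
  qed auto
  then show ?thesis using that by (simp add: \<R>_def)
qed

lemma relation_lift_singleton:
  assumes base: "generalized_base X S0 PP" and "S0 \<subseteq> Pow (X \<times> X)"
    and S0: "\<And>s. s \<in> S0 \<Longrightarrow> cc_relation S (lift s)"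
    and PP: "\<And>P. P \<in> PP \<Longrightarrow> cc_relation S (lift (Id_on P))" and "x \<in> X"
  shows "cc_relation S (lift (Id_on {x}))"
proof -
  obtain S' where S': "coherent_config X S'"
    "\<And>R. cc_relation S' R \<longleftrightarrow> R \<subseteq> X \<times> X \<and> cc_relation S (lift R)"
    using ex_quotient by blast
  interpret S': coherent X S' using S'(1) by unfold_locales
  have "cc_relation S' R" if R: "cc_relation S0 R" for R
  proof -
    obtain F where F: "F \<subseteq> S0" "R = (\<Union>s\<in>F. s)" using R by (auto simp: cc_relation_def)
    have "cc_relation S' s" if "s \<in> F" for s
      using that F(1) assms(2) S0 unfolding S'(2) by blast
    then show ?thesis unfolding F(2) by (rule cc_relation_UN)
  qed
  then have "fission X S0 S'" using S'(1) by (simp add: fission_def)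
  moreover have "\<forall>P\<in>PP. cc_set S' P"
    using base PP unfolding cc_set_def S'(2) generalized_base_def by auto
  ultimately have "cc_complete S'"
    using base unfolding generalized_base_iff[OF finite_X assms(2)] by blast
  then show ?thesis using S'.complete_iff \<open>x \<in> X\<close> S'(2) by (simp add: cc_set_def)
qed

end

section \<open>Antisymmetric configurations\<close>

lemma even_sum_involution:
  fixes g :: "'b \<Rightarrow> nat"
  assumes "\<And>x. x \<in> A \<Longrightarrow> h x \<in> A" "\<And>x. x \<in> A \<Longrightarrow> h (h x) = x" "\<And>x. x \<in> A \<Longrightarrow> h x \<noteq> x"
    and "\<And>x. x \<in> A \<Longrightarrow> g (h x) = g x"
  shows "even (\<Sum>x\<in>A. g x)"
proof -
  have "(\<Sum>x\<in>A. of_nat (g x) :: bit) = 0"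
    by (rule sum_involution_eq_0[of A _ h]) (use assms in simp_all)
  then show ?thesis by (metis even_of_nat_iff dvd_0_right of_nat_sum)
qed

lemma card_sym_diff_odd:
  assumes "finite A" "finite B" "odd (card B)"
  shows "card (sym_diff A B) \<noteq> card A"
proof
  assume "card (sym_diff A B) = card A"
  moreover have "card (sym_diff A B) = card (A - B) + card (B - A)"
    by (rule card_Un_disjoint) (use assms in auto)
  moreover have "card A = card (A - B) + card (A \<inter> B)" "card B = card (B - A) + card (A \<inter> B)"
    using assms card_Int_Diff[of A B] card_Int_Diff[of B A] by (simp_all add: Int_commute)
  ultimately show False using assms(3) by simp
qed

context coherent
begin

lemma basic_subset_Id: "t \<in> S \<Longrightarrow> (a, a) \<in> t \<Longrightarrow> t \<subseteq> Id_on \<Omega>"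
  using relation_saturated[OF relation_Id, of t "(a, a)"] basic_subset by blast

lemma card_Image_eq:
  assumes "s \<in> S" "(a, a) \<in> s" "(b, b) \<in> s" "t \<in> S"
  shows "card (t `` {a}) = card (t `` {b})"
  using basic_card[OF assms(4) basic_converse[OF assms(4)] assms(1-3)] by (simp add: Image_def)

lemma card_basic_in_fiber:
  assumes fiber: "Id_on \<Phi> \<in> S" and t: "t \<in> S" "t \<subseteq> \<Phi> \<times> \<Phi>" and "x \<in> \<Phi>"
  shows "card t = card \<Phi> * card (t `` {x})"
proof -
  have fin: "finite \<Phi>" by (rule set_finite[OF set_fiber[OF fiber]])
  have "t = Sigma \<Phi> (\<lambda>a. t `` {a})" using t by auto
  also have "card \<dots> = (\<Sum>a\<in>\<Phi>. card (t `` {a}))"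
    by (rule card_SigmaI[OF fin]) (use t in \<open>auto intro!: finite_subset[OF _ fin]\<close>)
  also have "\<dots> = (\<Sum>a\<in>\<Phi>. card (t `` {x}))"
    by (rule sum.cong) (use card_Image_eq[OF fiber _ _ t(1)] \<open>x \<in> \<Phi>\<close> in auto)
  finally show ?thesis by simp
qed

lemma card_converse_Image_in_fiber:
  assumes fiber: "Id_on \<Phi> \<in> S" and t: "t \<in> S" "t \<subseteq> \<Phi> \<times> \<Phi>" and x: "x \<in> \<Phi>"
  shows "card (t\<inverse> `` {x}) = card (t `` {x})"
proof -
  have "card \<Phi> * card (t\<inverse> `` {x}) = card (t\<inverse>)"
    by (rule card_basic_in_fiber[OF fiber basic_converse[OF t(1)] _ x, symmetric])
      (use t(2) in auto)
  also have "\<dots> = card t" by (rule card_inverse)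
  also have "\<dots> = card \<Phi> * card (t `` {x})" by (rule card_basic_in_fiber[OF fiber t x])
  finally have "card \<Phi> * card (t\<inverse> `` {x}) = card \<Phi> * card (t `` {x})" .
  moreover have "finite \<Phi>" by (rule set_finite[OF set_fiber[OF fiber]])
  ultimately show ?thesis using x by auto
qed

lemma antisymmetric_basic:
  assumes "cc_antisymmetric \<Omega> S" "t \<in> S" "(a, b) \<in> t" "(b, a) \<in> t"
  shows "a = b"
proof -
  have "t = t\<inverse>"
    using basic_unique[OF assms(2) basic_converse[OF assms(2)], of "(a, b)"] assms by simp
  then show ?thesis using assms unfolding cc_antisymmetric_def by blast
qed

lemma antisymmetric_odd_fiber:
  assumes antisymmetric: "cc_antisymmetric \<Omega> S" and fiber: "Id_on \<Phi> \<in> S"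
  shows "odd (card \<Phi>)"
proof -
  have \<Phi>: "cc_set S \<Phi>" by (rule set_fiber[OF fiber])
  have fin: "finite \<Phi>" by (rule set_finite[OF \<Phi>])
  obtain x where x: "x \<in> \<Phi>" using basic_nonempty[OF fiber] by auto
  define M where "M = {t \<in> S. t \<subseteq> \<Phi> \<times> \<Phi> \<and> \<not> t \<subseteq> Id_on \<Omega>}"
  have "\<Phi> - {x} = (\<Union>t\<in>M. t `` {x})"
  proof (intro equalityI subsetI)
    fix y assume y: "y \<in> \<Phi> - {x}"
    then obtain t where t: "t \<in> S" "(x, y) \<in> t" using ex_basic x set_subset[OF \<Phi>] by blast
    then have "t \<subseteq> \<Phi> \<times> \<Phi>" using relation_saturated[OF relation_Times[OF \<Phi> \<Phi>] t(1,2)] x y by blast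
    then show "y \<in> (\<Union>t\<in>M. t `` {x})" using t y unfolding M_def by auto
  next
    fix y assume "y \<in> (\<Union>t\<in>M. t `` {x})"
    then obtain t where "t \<in> S" "t \<subseteq> \<Phi> \<times> \<Phi>" "\<not> t \<subseteq> Id_on \<Omega>" "(x, y) \<in> t" by (auto simp: M_def)
    then show "y \<in> \<Phi> - {x}" using basic_subset_Id by blast
  qed
  also have "card \<dots> = (\<Sum>t\<in>M. card (t `` {x}))"
  proof (intro card_UN_disjoint ballI impI)
    show "finite M" using finite_basic by (simp add: M_def)
    show "finite (t `` {x})" if "t \<in> M" for t
      by (rule finite_subset[OF _ fin]) (use that in \<open>auto simp: M_def\<close>)
    show "s `` {x} \<inter> t `` {x} = {}" if "s \<in> M" "t \<in> M" "s \<noteq> t" for s t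
      using that basic_unique unfolding M_def by blast
  qed
  also have "even \<dots>"
  proof (rule even_sum_involution[where h = converse])
    fix t assume "t \<in> M"
    then have t: "t \<in> S" "t \<subseteq> \<Phi> \<times> \<Phi>" "\<not> t \<subseteq> Id_on \<Omega>" by (auto simp: M_def)
    then show "t\<inverse> \<in> M" using basic_converse by (auto simp: M_def)
    show "t\<inverse> \<noteq> t" using antisymmetric t unfolding cc_antisymmetric_def by metis
    show "card (t\<inverse> `` {x}) = card (t `` {x})"
      by (rule card_converse_Image_in_fiber[OF fiber t(1,2) x])
  qed simp
  finally show ?thesis using card.remove[OF fin x] by simp
qed

text \<open>Let \<open>a \<in> A\<close> and \<open>x \<notin> A\<close> lie in the same fiber. If \<open>(\<Omega> - A) \<times> A \<subseteq> t\<close>, then \<open>x\<close> has at least \<open>card A\<close>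
  out-neighbours in \<open>t\<close>, whereas those of \<open>a\<close> lie in \<open>A - {a}\<close> by antisymmetry.\<close>

lemma antisymmetric_not_subset_basic:
  assumes antisymmetric: "cc_antisymmetric \<Omega> S" and A: "A \<subseteq> \<Omega>" "\<not> cc_set S A" and t: "t \<in> S"
  shows "\<not> (\<Omega> - A) \<times> A \<subseteq> t"
proof
  assume sub: "(\<Omega> - A) \<times> A \<subseteq> t"
  obtain s p q where s: "s \<in> S" "p \<in> s" "q \<in> s" "p \<in> Id_on A" "q \<notin> Id_on A"
    using A relationI[of "Id_on A"] unfolding cc_set_def by blast
  then obtain a where a: "p = (a, a)" "a \<in> A" by auto
  then have "q \<in> Id_on \<Omega>" using basic_subset_Id s by blast
  then obtain x where x: "q = (x, x)" "x \<in> \<Omega> - A" using s(5) by auto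
  have finite_Image: "finite (t `` {y})" for y
    by (rule relation_finite_Image[OF cc_relation_basic[OF t]])
  have "t `` {a} \<subseteq> A - {a}"
  proof
    fix z assume "z \<in> t `` {a}"
    then have z: "(a, z) \<in> t" "z \<in> \<Omega>" using basic_subset t by auto
    have "(x, a) \<in> t" using sub a x by auto
    then have "z \<noteq> a" using z(1) basic_subset_Id[OF t, of a] a x by auto
    moreover from this have "z \<in> A"
      using sub z a(2) antisymmetric_basic[OF antisymmetric t, of a z] by blast
    ultimately show "z \<in> A - {a}" by simp
  qed
  moreover have "A \<subseteq> t `` {x}" using sub x by auto
  ultimately have "t `` {a} \<subset> t `` {x}" using a(2) by blast
  then have "card (t `` {a}) < card (t `` {x})"
    using finite_Image by (rule psubset_card_mono[rotated])
  then show False using card_Image_eq[OF s(1) _ _ t, of a x] s(2,3) a x by simp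
qed

end

section \<open>Tuples and the Hamming distance\<close>

declare One_nat_def [simp del] atLeastAtMost_iff [simp del]

lemma tuples_mem: "a \<in> tuples m \<Gamma> \<Longrightarrow> i \<in> {1..m} \<Longrightarrow> a i \<in> \<Gamma>"
  by (auto simp: tuples_def)

lemma tuples_eqI: "a \<in> tuples m \<Gamma> \<Longrightarrow> b \<in> tuples m \<Gamma> \<Longrightarrow> (\<And>i. i \<in> {1..m} \<Longrightarrow> a i = b i) \<Longrightarrow> a = b"
  unfolding tuples_def by (rule PiE_ext)

lemma tuples_upd: "a \<in> tuples m \<Gamma> \<Longrightarrow> i \<in> {1..m} \<Longrightarrow> x \<in> \<Gamma> \<Longrightarrow> a(i := x) \<in> tuples m \<Gamma>"
  unfolding tuples_def by (auto simp: PiE_def extensional_def Pi_def)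

lemma finite_tuples: "finite \<Gamma> \<Longrightarrow> finite (tuples m \<Gamma>)"
  by (simp add: tuples_def finite_PiE)

lemma PiE_tuples_iff:
  assumes "\<And>i. i \<in> {1..m} \<Longrightarrow> w i \<subseteq> \<Gamma>"
  shows "a \<in> PiE {1..m} w \<longleftrightarrow> a \<in> tuples m \<Gamma> \<and> (\<forall>i\<in>{1..m}. a i \<in> w i)"
  using assms by (auto simp: tuples_def PiE_iff subset_iff)

lemma PiE_singleton_tuple: "a \<in> tuples m \<Gamma> \<Longrightarrow> PiE {1..m} (\<lambda>i. {a i}) = {a}"
  unfolding tuples_def by (intro PiE_singleton) (simp add: PiE_def)

definition hamming :: "'i set \<Rightarrow> ('i \<Rightarrow> 'a) \<Rightarrow> ('i \<Rightarrow> 'a) \<Rightarrow> nat" where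
  "hamming I a b = card {i \<in> I. a i \<noteq> b i}"

definition same_line :: "'i \<Rightarrow> ('i \<Rightarrow> 'a) \<Rightarrow> ('i \<Rightarrow> 'a) \<Rightarrow> bool" where
  "same_line i a b \<longleftrightarrow> (\<forall>j. j \<noteq> i \<longrightarrow> a j = b j)"

lemma same_line_sym: "same_line i a b \<Longrightarrow> same_line i b a"
  and same_line_trans: "same_line i a b \<Longrightarrow> same_line i b c \<Longrightarrow> same_line i a c"
  and same_line_common: "same_line i a b \<Longrightarrow> same_line i a c \<Longrightarrow> same_line i b c"
  and same_line_upd: "same_line i a (a(i := x))"
  by (auto simp: same_line_def)

lemma same_line_iff_upd: "same_line i a b \<longleftrightarrow> b = a(i := b i)"
  by (auto simp: same_line_def fun_eq_iff)

lemma same_line_commute: "same_line i a b \<longleftrightarrow> same_line i b a"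
  by (auto simp: same_line_def)

lemma same_line_unique: "same_line i a b \<Longrightarrow> same_line j a b \<Longrightarrow> a i \<noteq> b i \<Longrightarrow> j = i"
  by (auto simp: same_line_def)

lemma same_line_tuplesI:
  assumes "a \<in> tuples m \<Gamma>" "b \<in> tuples m \<Gamma>" "\<And>j. j \<in> {1..m} \<Longrightarrow> j \<noteq> i \<Longrightarrow> a j = b j"
  shows "same_line i a b"
  unfolding same_line_def
proof (intro allI impI)
  fix j assume "j \<noteq> i"
  then show "a j = b j"
    using assms(3) assms(1,2)[unfolded tuples_def, THEN PiE_arb] by (cases "j \<in> {1..m}") simp_all
qed

lemma hamming_Suc_iff:
  assumes "finite I" "i \<in> I" "same_line i a b"
  shows "hamming I a c = hamming I b c + 1 \<longleftrightarrow> a i \<noteq> c i \<and> b i = c i"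
proof -
  let ?A = "{j \<in> I - {i}. a j \<noteq> c j}"
  have "{j \<in> I. a j \<noteq> c j} = (if a i \<noteq> c i then insert i ?A else ?A)" using assms(2) by auto
  moreover have "{j \<in> I. b j \<noteq> c j} = (if b i \<noteq> c i then insert i ?A else ?A)"
    using assms(2,3) by (auto simp: same_line_def)
  moreover have "finite ?A" "i \<notin> ?A" using assms(1) by auto
  ultimately show ?thesis by (auto simp: hamming_def)
qed

lemma hamming_eq_1_iff:
  assumes "a \<in> tuples m \<Gamma>" "b \<in> tuples m \<Gamma>"
  shows "hamming {1..m} a b = 1 \<longleftrightarrow> (\<exists>i\<in>{1..m}. same_line i a b \<and> a i \<noteq> b i)"
proof
  assume "hamming {1..m} a b = 1"
  then obtain i where i: "{i \<in> {1..m}. a i \<noteq> b i} = {i}"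
    unfolding hamming_def by (rule card_1_singletonE)
  then have "same_line i a b" by (intro same_line_tuplesI[OF assms]) blast
  then show "\<exists>i\<in>{1..m}. same_line i a b \<and> a i \<noteq> b i" using i by blast
next
  assume "\<exists>i\<in>{1..m}. same_line i a b \<and> a i \<noteq> b i"
  then obtain i where "{j \<in> {1..m}. a j \<noteq> b j} = {i}" by (auto simp: same_line_def)
  then show "hamming {1..m} a b = 1" by (simp add: hamming_def)
qed

section \<open>Relations of an exponentiation\<close>

lemma perm_tuple_tuples:
  assumes "l permutes {1..m}" "a \<in> tuples m \<Gamma>"
  shows "perm_tuple l a \<in> tuples m \<Gamma>"
proof -
  have inv: "inv l permutes {1..m}" using assms(1) by (rule permutes_inv)
  have "a (inv l i) \<in> \<Gamma>" if "i \<in> {1..m}" for i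
    using tuples_mem[OF assms(2)] permutes_in_image[OF inv] that by blast
  moreover have "a (inv l i) = undefined" if "i \<notin> {1..m}" for i
    using PiE_arb[OF assms(2)[unfolded tuples_def] that] permutes_not_in[OF inv that] by simp
  ultimately show ?thesis
    unfolding tuples_def perm_tuple_def by (auto simp: PiE_def extensional_def)
qed

lemma exp_rels_subset:
  assumes "perm_group_on m L"
  shows "exp_rels m \<Gamma> T L \<subseteq> Pow (tuples m \<Gamma> \<times> tuples m \<Gamma>)"
proof -
  have "l permutes {1..m}" if "l \<in> L" for l using assms that by (simp add: perm_group_on_def)
  then show ?thesis
    unfolding exp_rels_def perm_rel_def tensor_def by (auto intro!: perm_tuple_tuples)
qed

lemma Inv_rels_subset:
  assumes "perm_group_on m L"
  shows "Inv_rels m L \<subseteq> Pow ({1..m} \<times> {1..m})"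
proof -
  have "l i \<in> {1..m}" if "l \<in> L" "i \<in> {1..m}" for l i
    using assms that permutes_in_image[of l "{1..m}" i] by (simp add: perm_group_on_def)
  then show ?thesis unfolding Inv_rels_def by blast
qed

definition sym_tensor :: "nat \<Rightarrow> 'a set \<Rightarrow> (nat \<Rightarrow> nat) set \<Rightarrow> (nat \<Rightarrow> 'a rel) \<Rightarrow> (nat \<Rightarrow> 'a) rel" where
  "sym_tensor m \<Gamma> L R = (\<Union>l\<in>L. perm_rel l (tensor m \<Gamma> R))"

lemma cc_relation_sym_tensor:
  assumes R: "\<And>i. i \<in> {1..m} \<Longrightarrow> cc_relation T (R i)"
  shows "cc_relation (exp_rels m \<Gamma> T L) (sym_tensor m \<Gamma> L R)"
  unfolding cc_relation_iff
proof
  fix p assume "p \<in> sym_tensor m \<Gamma> L R"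
  then obtain l a b where l: "l \<in> L" and p: "p = (perm_tuple l a, perm_tuple l b)"
    and ab: "(a, b) \<in> tensor m \<Gamma> R"
    by (auto simp: sym_tensor_def perm_rel_def)
  have "\<exists>t\<in>T. (a i, b i) \<in> t \<and> t \<subseteq> R i" if "i \<in> {1..m}" for i
    using ab R[OF that] that unfolding tensor_def cc_relation_iff by auto
  then obtain t where t: "\<And>i. i \<in> {1..m} \<Longrightarrow> t i \<in> T \<and> (a i, b i) \<in> t i \<and> t i \<subseteq> R i" by metis
  have "sym_tensor m \<Gamma> L t \<in> exp_rels m \<Gamma> T L"
    unfolding exp_rels_def sym_tensor_def using t by blast
  moreover have "(a, b) \<in> tensor m \<Gamma> t" "tensor m \<Gamma> t \<subseteq> tensor m \<Gamma> R"
    using ab t unfolding tensor_def by blast+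
  then have "p \<in> perm_rel l (tensor m \<Gamma> t)"
    "\<And>l. perm_rel l (tensor m \<Gamma> t) \<subseteq> perm_rel l (tensor m \<Gamma> R)"
    unfolding p perm_rel_def by blast+
  then have "p \<in> sym_tensor m \<Gamma> L t" "sym_tensor m \<Gamma> L t \<subseteq> sym_tensor m \<Gamma> L R"
    using l unfolding sym_tensor_def by auto
  ultimately show "\<exists>s\<in>exp_rels m \<Gamma> T L. p \<in> s \<and> s \<subseteq> sym_tensor m \<Gamma> L R"
    by (intro bexI[of _ "sym_tensor m \<Gamma> L t"] conjI)
qed

lemma mem_perm_rel_tensor_iff:
  assumes l: "l permutes {1..m}"
  shows "(a, b) \<in> perm_rel l (tensor m \<Gamma> R) \<longleftrightarrow>
    a \<in> tuples m \<Gamma> \<and> b \<in> tuples m \<Gamma> \<and> (\<forall>i\<in>{1..m}. (a (l i), b (l i)) \<in> R i)" (is "_ \<longleftrightarrow> ?rhs")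
proof
  note inverses = permutes_inverses[OF l]
  show ?rhs if "(a, b) \<in> perm_rel l (tensor m \<Gamma> R)"
    using that perm_tuple_tuples[OF l]
    by (auto simp: perm_rel_def tensor_def perm_tuple_def inverses)
  assume rhs: ?rhs
  let ?a = "perm_tuple (inv l) a" and ?b = "perm_tuple (inv l) b"
  have "?a \<in> tuples m \<Gamma>" "?b \<in> tuples m \<Gamma>"
    using rhs perm_tuple_tuples[OF permutes_inv[OF l]] by blast+
  then have "(?a, ?b) \<in> tensor m \<Gamma> R"
    using rhs by (simp add: tensor_def perm_tuple_def permutes_inv_inv[OF l])
  moreover have "perm_tuple l ?a = a" "perm_tuple l ?b = b"
    by (simp_all add: perm_tuple_def permutes_inv_inv[OF l] inverses)
  ultimately show "(a, b) \<in> perm_rel l (tensor m \<Gamma> R)" unfolding perm_rel_def by force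
qed

lemma sym_tensor_iff:
  assumes "perm_group_on m L"
  shows "(a, b) \<in> sym_tensor m \<Gamma> L R \<longleftrightarrow>
    a \<in> tuples m \<Gamma> \<and> b \<in> tuples m \<Gamma> \<and> (\<exists>l\<in>L. \<forall>i\<in>{1..m}. (a (l i), b (l i)) \<in> R i)"
  using assms unfolding sym_tensor_def perm_group_on_def by (auto simp: mem_perm_rel_tensor_iff)

locale exp_fission =
  fixes \<Gamma> :: "'a set" and T :: "'a rel set" and m :: nat and L :: "(nat \<Rightarrow> nat) set"
    and Z :: "(nat \<Rightarrow> 'a) rel set"
  assumes coherent_T: "coherent_config \<Gamma> T" and group: "perm_group_on m L"
    and fission_Z: "fission (tuples m \<Gamma>) (exp_rels m \<Gamma> T L) Z"
begin

sublocale Y: coherent \<Gamma> T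
  using coherent_T by unfold_locales

sublocale Z: coherent "tuples m \<Gamma>" Z
  using fission_Z by (rule fission_coherent)

lemma permutes: "l \<in> L \<Longrightarrow> l permutes {1..m}"
  and id_mem: "id \<in> L"
  using group by (simp_all add: perm_group_on_def)

lemma perm_mem: "l \<in> L \<Longrightarrow> i \<in> {1..m} \<Longrightarrow> l i \<in> {1..m}"
  using permutes_in_image[OF permutes] by blast

lemma relation_sym_tensor:
  "(\<And>i. i \<in> {1..m} \<Longrightarrow> cc_relation T (R i)) \<Longrightarrow> cc_relation Z (sym_tensor m \<Gamma> L R)"
  using fission_Z cc_relation_sym_tensor[of m T R \<Gamma> L] unfolding fission_def by blast

lemma sym_tensorI:
  assumes "a \<in> tuples m \<Gamma>" "b \<in> tuples m \<Gamma>" "\<And>i. i \<in> {1..m} \<Longrightarrow> (a i, b i) \<in> R i"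
  shows "(a, b) \<in> sym_tensor m \<Gamma> L R"
  unfolding sym_tensor_iff[OF group] using assms id_mem by (auto intro!: bexI[of _ id])

lemma sym_tensorE:
  assumes "(a, b) \<in> sym_tensor m \<Gamma> L R"
  obtains l where "a \<in> tuples m \<Gamma>" "b \<in> tuples m \<Gamma>" "l \<in> L" "\<forall>i\<in>{1..m}. (a (l i), b (l i)) \<in> R i"
  using assms unfolding sym_tensor_iff[OF group] by (elim conjE bexE)

lemma set_power:
  assumes "cc_set T P"
  shows "cc_set Z (PiE {1..m} (\<lambda>_. P))"
proof -
  have P: "P \<subseteq> \<Gamma>" by (rule Y.set_subset[OF assms])
  have "Id_on (PiE {1..m} (\<lambda>_. P)) = sym_tensor m \<Gamma> L (\<lambda>_. Id_on P)"
  proof (intro equalityI subrelI)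
    fix a b assume "(a, b) \<in> Id_on (PiE {1..m} (\<lambda>_. P))"
    then show "(a, b) \<in> sym_tensor m \<Gamma> L (\<lambda>_. Id_on P)"
      by (intro sym_tensorI) (auto simp: PiE_tuples_iff[of m _ \<Gamma>] P)
  next
    fix a b assume "(a, b) \<in> sym_tensor m \<Gamma> L (\<lambda>_. Id_on P)"
    then obtain l where ab: "a \<in> tuples m \<Gamma>" "b \<in> tuples m \<Gamma>" and l: "l \<in> L"
      and "\<forall>i\<in>{1..m}. (a (l i), b (l i)) \<in> Id_on P" by (rule sym_tensorE)
    then have "\<forall>i\<in>l ` {1..m}. a i \<in> P \<and> a i = b i" by auto
    then have "\<forall>i\<in>{1..m}. a i \<in> P \<and> a i = b i" unfolding permutes_image[OF permutes[OF l]] .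
    then have "a \<in> PiE {1..m} (\<lambda>_. P)" "a = b"
      using ab P tuples_eqI[OF ab] by (simp_all add: PiE_tuples_iff[of m _ \<Gamma>])
    then show "(a, b) \<in> Id_on (PiE {1..m} (\<lambda>_. P))" by (auto simp: Id_on_iff)
  qed
  then show ?thesis using relation_sym_tensor assms unfolding cc_set_def by simp
qed

definition distance :: "nat \<Rightarrow> (nat \<Rightarrow> 'a) rel" where
  "distance n = {(a, b). a \<in> tuples m \<Gamma> \<and> b \<in> tuples m \<Gamma> \<and> hamming {1..m} a b = n}"

lemma relation_distance: "cc_relation Z (distance n)"
proof -
  define R where "R I i = (if i \<in> I then \<Gamma> \<times> \<Gamma> - Id_on \<Gamma> else Id_on \<Gamma>)" for I and i :: nat
  have "distance n = (\<Union>I\<in>{I. I \<subseteq> {1..m} \<and> card I = n}. sym_tensor m \<Gamma> L (R I))"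
  proof (intro equalityI subrelI)
    fix a b assume ab: "(a, b) \<in> distance n"
    then have "(a, b) \<in> sym_tensor m \<Gamma> L (R {i \<in> {1..m}. a i \<noteq> b i})"
      using tuples_mem by (intro sym_tensorI) (auto simp: distance_def R_def)
    then show "(a, b) \<in> (\<Union>I\<in>{I. I \<subseteq> {1..m} \<and> card I = n}. sym_tensor m \<Gamma> L (R I))"
      using ab by (auto simp: distance_def hamming_def intro!: exI[of _ "{i \<in> {1..m}. a i \<noteq> b i}"])
  next
    fix a b assume "(a, b) \<in> (\<Union>I\<in>{I. I \<subseteq> {1..m} \<and> card I = n}. sym_tensor m \<Gamma> L (R I))"
    then obtain I where I: "I \<subseteq> {1..m}" "card I = n" and "(a, b) \<in> sym_tensor m \<Gamma> L (R I)" by blast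
    from this(3) obtain l where ab: "a \<in> tuples m \<Gamma>" "b \<in> tuples m \<Gamma>" and l: "l \<in> L"
      and types: "\<forall>i\<in>{1..m}. (a (l i), b (l i)) \<in> R I i" by (rule sym_tensorE)
    have "a (l i) = b (l i) \<longleftrightarrow> i \<notin> I" if "i \<in> {1..m}" for i
      using bspec[OF types that] by (auto simp: R_def split: if_splits)
    then have "{i \<in> l ` {1..m}. a i \<noteq> b i} = l ` I" using I(1) by auto
    then have "hamming {1..m} a b = card (l ` I)"
      unfolding hamming_def permutes_image[OF permutes[OF l]] by simp
    also have "\<dots> = n"
      using card_image[OF inj_on_subset[OF permutes_inj[OF permutes[OF l]]]] I(2) by simp
    finally show "(a, b) \<in> distance n" using ab by (simp add: distance_def)
  qed
  moreover have "cc_relation Z (sym_tensor m \<Gamma> L (R I))" for I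
    by (rule relation_sym_tensor)
      (simp add: R_def Y.relation_Id Y.relation_Diff[OF Y.relation_full])
  ultimately show ?thesis by (simp add: cc_relation_UN)
qed

definition step :: "'a rel \<Rightarrow> (nat \<Rightarrow> 'a) rel" where
  "step R = {(a, b). a \<in> tuples m \<Gamma> \<and> b \<in> tuples m \<Gamma> \<and>
    (\<exists>i\<in>{1..m}. same_line i a b \<and> (a i, b i) \<in> R)}"

lemma relation_step:
  assumes R: "cc_relation T R"
  shows "cc_relation Z (step R)"
proof -
  define R' where "R' i k = (if k = i then R else Id_on \<Gamma>)" for i k :: nat
  have "step R = (\<Union>i\<in>{1..m}. sym_tensor m \<Gamma> L (R' i))"
  proof (intro equalityI subrelI)
    fix a b assume "(a, b) \<in> step R"
    then obtain i where ab: "a \<in> tuples m \<Gamma>" "b \<in> tuples m \<Gamma>"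
      and i: "i \<in> {1..m}" "same_line i a b" "(a i, b i) \<in> R" by (auto simp: step_def)
    then have "(a, b) \<in> sym_tensor m \<Gamma> L (R' i)"
      using tuples_mem by (intro sym_tensorI) (auto simp: same_line_def R'_def)
    then show "(a, b) \<in> (\<Union>i\<in>{1..m}. sym_tensor m \<Gamma> L (R' i))" using i(1) by blast
  next
    fix a b assume "(a, b) \<in> (\<Union>i\<in>{1..m}. sym_tensor m \<Gamma> L (R' i))"
    then obtain i where i: "i \<in> {1..m}" and "(a, b) \<in> sym_tensor m \<Gamma> L (R' i)" by blast
    from this(2) obtain l where ab: "a \<in> tuples m \<Gamma>" "b \<in> tuples m \<Gamma>" and l: "l \<in> L"
      and types: "\<forall>k\<in>{1..m}. (a (l k), b (l k)) \<in> R' i k" by (rule sym_tensorE)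
    have "same_line (l i) a b"
    proof (rule same_line_tuplesI[OF ab])
      fix j assume "j \<in> {1..m}" "j \<noteq> l i"
      then obtain k where "k \<in> {1..m}" "j = l k" using permutes_image[OF permutes[OF l]] by blast
      then show "a j = b j" using types \<open>j \<noteq> l i\<close> by (auto simp: R'_def split: if_splits)
    qed
    then show "(a, b) \<in> step R"
      using ab bspec[OF types i] perm_mem[OF l i] by (auto simp: step_def R'_def)
  qed
  moreover have "cc_relation Z (sym_tensor m \<Gamma> L (R' i))" for i
    by (rule relation_sym_tensor) (simp add: R R'_def Y.relation_Id)
  ultimately show ?thesis by (simp add: cc_relation_UN)
qed

lemma distance_1_iff:
  "(a, b) \<in> distance 1 \<longleftrightarrow> a \<in> tuples m \<Gamma> \<and> b \<in> tuples m \<Gamma> \<and>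
    (\<exists>i\<in>{1..m}. same_line i a b \<and> a i \<noteq> b i)"
  using hamming_eq_1_iff[of a m \<Gamma> b] by (auto simp: distance_def)

definition closer :: "(nat \<Rightarrow> 'a) rel \<Rightarrow> (nat \<Rightarrow> 'a) rel" where
  "closer R = {(a, b). a \<in> tuples m \<Gamma> \<and> b \<in> tuples m \<Gamma> \<and>
    (\<exists>q. (a, q) \<in> R \<and> hamming {1..m} a b = hamming {1..m} q b + 1)}"

lemma relation_closer:
  assumes R: "cc_relation Z R"
  shows "cc_relation Z (closer R)"
proof -
  have "closer R = (\<Union>n. distance (n + 1) \<inter> (R O distance n))"
    using Z.relation_subset[OF R] by (auto simp: closer_def distance_def)
  moreover have "cc_relation Z (distance (n + 1) \<inter> (R O distance n))" for n
    by (intro Z.relation_Int Z.relation_relcomp relation_distance R)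
  ultimately show ?thesis by (simp add: cc_relation_UN)
qed

definition towards :: "(nat \<Rightarrow> 'a) set \<Rightarrow> (nat \<Rightarrow> 'a) rel" where
  "towards W = {(a, b) \<in> distance 1. \<exists>q\<in>W. hamming {1..m} a q = hamming {1..m} b q + 1}"

lemma relation_towards:
  assumes W: "cc_set Z W"
  shows "cc_relation Z (towards W)"
proof -
  have "towards W = distance 1 \<inter> (\<Union>n. distance (n + 1) O Id_on W O (distance n)\<inverse>)"
    using Z.set_subset[OF W] by (fastforce simp: towards_def distance_def)
  moreover have "cc_relation Z (\<Union>n. distance (n + 1) O Id_on W O (distance n)\<inverse>)"
    using W unfolding cc_set_def
    by (intro cc_relation_UN Z.relation_relcomp Z.relation_converse relation_distance)
  ultimately show ?thesis using Z.relation_Int[OF relation_distance] by simp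
qed

lemma towards_PiE_iff:
  assumes w: "\<And>i. i \<in> {1..m} \<Longrightarrow> w i \<noteq> {}"
  shows "(a, b) \<in> towards (PiE {1..m} w) \<longleftrightarrow> a \<in> tuples m \<Gamma> \<and> b \<in> tuples m \<Gamma> \<and>
    (\<exists>i\<in>{1..m}. same_line i a b \<and> a i \<noteq> b i \<and> b i \<in> w i)"
proof
  assume "(a, b) \<in> towards (PiE {1..m} w)"
  then obtain q i where ab: "a \<in> tuples m \<Gamma>" "b \<in> tuples m \<Gamma>" and q: "q \<in> PiE {1..m} w"
    and less: "hamming {1..m} a q = hamming {1..m} b q + 1"
    and i: "i \<in> {1..m}" "same_line i a b" "a i \<noteq> b i"
    unfolding towards_def distance_1_iff by blast
  have "b i = q i" using hamming_Suc_iff[OF _ i(1,2)] less by simp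
  then show "a \<in> tuples m \<Gamma> \<and> b \<in> tuples m \<Gamma> \<and> (\<exists>i\<in>{1..m}. same_line i a b \<and> a i \<noteq> b i \<and> b i \<in> w i)"
    using ab i q PiE_mem by metis
next
  assume "a \<in> tuples m \<Gamma> \<and> b \<in> tuples m \<Gamma> \<and> (\<exists>i\<in>{1..m}. same_line i a b \<and> a i \<noteq> b i \<and> b i \<in> w i)"
  then obtain i where ab: "a \<in> tuples m \<Gamma>" "b \<in> tuples m \<Gamma>"
    and i: "i \<in> {1..m}" "same_line i a b" "a i \<noteq> b i" "b i \<in> w i" by blast
  obtain p where "p \<in> PiE {1..m} w" using w by (metis PiE_eq_empty_iff ex_in_conv)
  then have "p(i := b i) \<in> PiE {1..m} w" using i by (auto simp: PiE_iff extensional_def)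
  moreover have "hamming {1..m} a (p(i := b i)) = hamming {1..m} b (p(i := b i)) + 1"
    using hamming_Suc_iff[OF _ i(1,2)] i(3) by simp
  moreover have "(a, b) \<in> distance 1" unfolding distance_1_iff using ab i by blast
  ultimately show "(a, b) \<in> towards (PiE {1..m} w)" unfolding towards_def by blast
qed

end

section \<open>Leaving a box in one coordinate\<close>

locale exp_box = exp_fission +
  fixes Q :: "nat \<Rightarrow> 'a set"
  assumes transitive: "transitive_on m L"
    and Q_subset: "\<And>i. i \<in> {1..m} \<Longrightarrow> Q i \<subseteq> \<Gamma>"
    and Q_nonempty: "\<And>i. i \<in> {1..m} \<Longrightarrow> Q i \<noteq> {}"
    and Q_proper: "\<And>i. i \<in> {1..m} \<Longrightarrow> \<Gamma> - Q i \<noteq> {}"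
    and set_PiE_Q: "cc_set Z (PiE {1..m} Q)"
    and Q_crossing: "\<And>i j t. i \<in> {1..m} \<Longrightarrow> j \<in> {1..m} \<Longrightarrow> t \<in> T \<Longrightarrow>
      \<not> ((\<Gamma> - Q i) \<times> Q i \<subseteq> t \<and> Q j \<times> (\<Gamma> - Q j) \<subseteq> t)"
begin

definition box :: "(nat \<Rightarrow> 'a) set" where
  "box = {a \<in> tuples m \<Gamma>. \<forall>i\<in>{1..m}. a i \<in> Q i}"

definition tube :: "nat \<Rightarrow> (nat \<Rightarrow> 'a) set" where
  "tube i = {a \<in> tuples m \<Gamma>. \<forall>j\<in>{1..m} - {i}. a j \<in> Q j}"

definition exit :: "nat \<Rightarrow> (nat \<Rightarrow> 'a) set" where
  "exit i = {a \<in> tube i. a i \<notin> Q i}"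

definition exits :: "(nat \<Rightarrow> 'a) set" where
  "exits = (\<Union>i\<in>{1..m}. exit i)"

lemma set_box: "cc_set Z box"
proof -
  have "box = PiE {1..m} Q" using PiE_tuples_iff[of m Q \<Gamma>] Q_subset unfolding box_def by blast
  then show ?thesis using set_PiE_Q by simp
qed

lemma box_nonempty: "box \<noteq> {}"
proof -
  have "PiE {1..m} Q \<noteq> {}" using Q_nonempty by (simp add: PiE_eq_empty_iff)
  then show ?thesis using Q_subset PiE_tuples_iff[of m Q \<Gamma>] unfolding box_def by blast
qed

lemma box_subset_tube: "box \<subseteq> tube i"
  by (auto simp: box_def tube_def)

lemma box_iff_tube: "i \<in> {1..m} \<Longrightarrow> a \<in> box \<longleftrightarrow> a \<in> tube i \<and> a i \<in> Q i"
  by (auto simp: box_def tube_def)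

lemma tube_tuples: "a \<in> tube i \<Longrightarrow> a \<in> tuples m \<Gamma>"
  by (simp add: tube_def)

lemma exit_tube: "a \<in> exit i \<Longrightarrow> a \<in> tube i"
  by (simp add: exit_def)

lemma exit_tuples: "a \<in> exit i \<Longrightarrow> a \<in> tuples m \<Gamma>"
  using exit_tube tube_tuples by blast

lemma tube_same_line: "a \<in> tube i \<Longrightarrow> b \<in> tuples m \<Gamma> \<Longrightarrow> same_line i a b \<Longrightarrow> b \<in> tube i"
  by (simp add: tube_def same_line_def)

lemma tube_upd: "a \<in> tube i \<Longrightarrow> i \<in> {1..m} \<Longrightarrow> x \<in> \<Gamma> \<Longrightarrow> a(i := x) \<in> tube i"
  by (auto simp: tube_def tuples_upd)

lemma box_upd: "a \<in> tube i \<Longrightarrow> i \<in> {1..m} \<Longrightarrow> x \<in> Q i \<Longrightarrow> a(i := x) \<in> box"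
  using Q_subset by (auto simp: box_iff_tube intro!: tube_upd)

lemma exit_unique: "a \<in> exit i \<Longrightarrow> a \<in> exit j \<Longrightarrow> i \<in> {1..m} \<Longrightarrow> j \<in> {1..m} \<Longrightarrow> i = j"
  unfolding exit_def tube_def by blast

lemma exit_entry: "a \<in> exit i \<Longrightarrow> j \<in> {1..m} \<Longrightarrow> j \<noteq> i \<Longrightarrow> a j \<in> Q j"
  by (auto simp: exit_def tube_def)

lemma exit_nonempty:
  assumes "i \<in> {1..m}"
  shows "exit i \<noteq> {}"
proof -
  obtain q x where "q \<in> box" "x \<in> \<Gamma> - Q i" using box_nonempty Q_proper[OF assms] by blast
  then have "q(i := x) \<in> exit i"
    using box_subset_tube[of i] tube_upd[of q i x] assms by (auto simp: exit_def)
  then show ?thesis by blast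
qed

lemma set_exits: "cc_set Z exits"
proof -
  have "exits = Range (distance 1 \<inter> box \<times> tuples m \<Gamma>) - box"
  proof (intro equalityI subsetI)
    fix a assume "a \<in> exits"
    then obtain i where i: "i \<in> {1..m}" and a: "a \<in> exit i" by (auto simp: exits_def)
    obtain x where x: "x \<in> Q i" using Q_nonempty[OF i] by blast
    have box: "a(i := x) \<in> box" by (rule box_upd[OF exit_tube[OF a] i x])
    have "a i \<noteq> x" using a x by (auto simp: exit_def)
    then have "(a(i := x), a) \<in> distance 1"
      unfolding distance_1_iff using box i same_line_sym[OF same_line_upd] exit_tuples[OF a]
      by (auto simp: box_def intro!: bexI[of _ i])
    moreover have "a \<notin> box" using a i by (simp add: box_iff_tube exit_def)
    ultimately show "a \<in> Range (distance 1 \<inter> box \<times> tuples m \<Gamma>) - box"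
      using box exit_tuples[OF a] by blast
  next
    fix a assume "a \<in> Range (distance 1 \<inter> box \<times> tuples m \<Gamma>) - box"
    then obtain q i where "q \<in> box" "a \<in> tuples m \<Gamma>" "a \<notin> box" and i: "i \<in> {1..m}" "same_line i q a"
      by (auto simp: distance_1_iff)
    then have "a \<in> exit i"
      using tube_same_line[OF _ _ i(2)] box_subset_tube[of i] box_iff_tube[OF i(1)]
      by (auto simp: exit_def)
    then show "a \<in> exits" using i(1) by (auto simp: exits_def)
  qed
  moreover have "cc_set Z (Range (distance 1 \<inter> box \<times> tuples m \<Gamma>) - box)"
    by (intro Z.set_Diff Z.set_Range Z.relation_restrict set_box relation_distance Z.set_full)
  ultimately show ?thesis by simp
qed

definition return :: "(nat \<Rightarrow> 'a) rel" where
  "return = distance 1 \<inter> exits \<times> box"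

lemma relation_return: "cc_relation Z return"
  unfolding return_def by (rule Z.relation_restrict[OF set_exits relation_distance set_box])

lemma return_iff:
  assumes a: "a \<in> exit i" and i: "i \<in> {1..m}"
  shows "(a, q) \<in> return \<longleftrightarrow> q \<in> box \<and> same_line i a q"
proof
  assume "(a, q) \<in> return"
  then obtain j where q: "q \<in> box" "same_line j a q" by (auto simp: return_def distance_1_iff)
  then have "a i \<noteq> q i" using a i by (auto simp: box_def exit_def)
  then have "j = i" using q(2) unfolding same_line_def by metis
  then show "q \<in> box \<and> same_line i a q" using q by simp
next
  assume q: "q \<in> box \<and> same_line i a q"
  then have "a i \<noteq> q i" using a i by (auto simp: box_def exit_def)
  then show "(a, q) \<in> return"
    using a i q exit_tuples[OF a] by (auto simp: return_def distance_1_iff exits_def box_def)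
qed

lemma return_upd:
  assumes "a \<in> exit i" "i \<in> {1..m}" "b \<in> tube i" "same_line i a b" "x \<in> Q i"
  shows "(a, b(i := x)) \<in> return"
  unfolding return_iff[OF assms(1,2)]
  using box_upd[OF assms(3,2,5)] same_line_trans[OF assms(4) same_line_upd] by blast

lemma return_step_iff:
  assumes a: "a \<in> exit i" and i: "i \<in> {1..m}"
  shows "(a, q) \<in> return \<inter> step R \<longleftrightarrow> q \<in> box \<and> same_line i a q \<and> (a i, q i) \<in> R"
    and "(q, a) \<in> return\<inverse> \<inter> step R \<longleftrightarrow> q \<in> box \<and> same_line i q a \<and> (q i, a i) \<in> R"
proof -
  have "a i \<noteq> q i" if "q \<in> box" using that a i by (auto simp: box_def exit_def)
  then have unique: "j = i" if "q \<in> box" "same_line i a q" "same_line j a q" for j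
    using that same_line_unique by metis
  have "a \<in> tuples m \<Gamma>" by (rule exit_tuples[OF a])
  then show "(a, q) \<in> return \<inter> step R \<longleftrightarrow> q \<in> box \<and> same_line i a q \<and> (a i, q i) \<in> R"
    using return_iff[OF a i] unique i by (auto simp: step_def box_def)
  show "(q, a) \<in> return\<inverse> \<inter> step R \<longleftrightarrow> q \<in> box \<and> same_line i q a \<and> (q i, a i) \<in> R"
    using return_iff[OF a i] unique i \<open>a \<in> tuples m \<Gamma>\<close>
    by (auto simp: step_def box_def same_line_commute[of _ q a])
qed

definition same_exit :: "(nat \<Rightarrow> 'a) rel" where
  "same_exit = (\<Union>i\<in>{1..m}. exit i \<times> exit i)"

lemma same_exit_iff:
  "a \<in> exit i \<Longrightarrow> b \<in> exit j \<Longrightarrow> i \<in> {1..m} \<Longrightarrow> j \<in> {1..m} \<Longrightarrow> (a, b) \<in> same_exit \<longleftrightarrow> i = j"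
  unfolding same_exit_def using exit_unique by blast

lemma closer_return_iff:
  assumes a: "a \<in> exit i" and b: "b \<in> exit j" and i: "i \<in> {1..m}" and j: "j \<in> {1..m}"
  shows "(a, b) \<in> closer return \<longleftrightarrow> i \<noteq> j"
proof
  assume "(a, b) \<in> closer return"
  then obtain q where q: "q \<in> box" "same_line i a q"
    and less: "hamming {1..m} a b = hamming {1..m} q b + 1"
    using return_iff[OF a i] by (auto simp: closer_def)
  have "q i = b i" using hamming_Suc_iff[OF _ i q(2)] less by simp
  then show "i \<noteq> j" using q(1) b i by (auto simp: box_def exit_def)
next
  assume "i \<noteq> j"
  then have bi: "b i \<in> Q i" using exit_entry[OF b i] by simp
  then have "(a, a(i := b i)) \<in> return"
    by (intro return_upd[OF a i exit_tube[OF a]]) (simp_all add: same_line_def)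
  moreover have "a i \<noteq> b i" using a bi by (auto simp: exit_def)
  then have "hamming {1..m} a b = hamming {1..m} (a(i := b i)) b + 1"
    using hamming_Suc_iff[OF _ i same_line_upd[of i a "b i"], of b] by simp
  ultimately show "(a, b) \<in> closer return"
    using exit_tuples[OF a] exit_tuples[OF b] unfolding closer_def by blast
qed

lemma relation_same_exit: "cc_relation Z same_exit"
proof -
  have "same_exit = exits \<times> exits - closer return"
    using closer_return_iff same_exit_iff unfolding exits_def by (auto simp: same_exit_def; metis)
  moreover have "cc_relation Z (exits \<times> exits - closer return)"
    by (intro Z.relation_Diff Z.relation_Times set_exits relation_closer relation_return)
  ultimately show ?thesis by simp
qed

definition slice :: "(nat \<Rightarrow> 'a set) \<Rightarrow> (nat \<Rightarrow> 'a) rel" where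
  "slice w = {(a, b). \<exists>i\<in>{1..m}. a \<in> exit i \<and> b \<in> tuples m \<Gamma> \<and> same_line i a b \<and> b i \<in> w i}"

lemma slice_iff:
  "a \<in> exit i \<Longrightarrow> i \<in> {1..m} \<Longrightarrow>
    (a, b) \<in> slice w \<longleftrightarrow> b \<in> tuples m \<Gamma> \<and> same_line i a b \<and> b i \<in> w i"
  unfolding slice_def using exit_unique by blast

lemma sliceE:
  assumes "(a, b) \<in> slice w"
  obtains i where "i \<in> {1..m}" "a \<in> exit i" "b \<in> tuples m \<Gamma>" "same_line i a b" "b i \<in> w i"
  using assms unfolding slice_def by blast

lemma slice_upd:
  assumes "a \<in> exit i" "i \<in> {1..m}" "x \<in> w i" "x \<in> \<Gamma>"
  shows "(a, a(i := x)) \<in> slice w"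
  unfolding slice_iff[OF assms(1,2)] using assms exit_tuples by (simp add: tuples_upd same_line_upd)

lemma same_line_iff_return:
  assumes a: "a \<in> exit i" and i: "i \<in> {1..m}"
  shows "(a, b) \<in> return \<union> (same_exit \<inter> (return O return\<inverse>)) \<longleftrightarrow> b \<in> tuples m \<Gamma> \<and> same_line i a b"
proof (intro iffI; (elim conjE)?)
  assume b: "b \<in> tuples m \<Gamma>" "same_line i a b"
  have tube: "b \<in> tube i" by (rule tube_same_line[OF exit_tube[OF a] b])
  show "(a, b) \<in> return \<union> (same_exit \<inter> (return O return\<inverse>))"
  proof (cases "b i \<in> Q i")
    case True
    then show ?thesis using return_iff[OF a i] box_iff_tube[OF i] tube b by blast
  next
    case False
    then have exit: "b \<in> exit i" using tube by (simp add: exit_def)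
    obtain x where x: "x \<in> Q i" using Q_nonempty[OF i] by blast
    have "same_line i b b" by (simp add: same_line_def)
    then have "(a, b(i := x)) \<in> return" "(b, b(i := x)) \<in> return"
      using return_upd[OF a i tube b(2) x] return_upd[OF exit i tube _ x] by blast+
    then show ?thesis using a exit i unfolding same_exit_def by blast
  qed
next
  assume ab: "(a, b) \<in> return \<union> (same_exit \<inter> (return O return\<inverse>))"
  show "b \<in> tuples m \<Gamma> \<and> same_line i a b"
  proof (cases "(a, b) \<in> return")
    case False
    then obtain q where q: "(a, q) \<in> return" "(b, q) \<in> return" and "(a, b) \<in> same_exit"
      using ab by auto
    then have b: "b \<in> exit i" unfolding same_exit_def using a i exit_unique by blast
    have "same_line i q a" "same_line i q b"
      using q by (simp_all add: return_iff[OF a i] return_iff[OF b i] same_line_sym)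
    then show ?thesis using same_line_common exit_tuples[OF b] by simp
  qed (use return_iff[OF a i] in \<open>auto simp: box_def\<close>)
qed

lemma relation_slice_full: "cc_relation Z (slice (\<lambda>_. \<Gamma>))"
proof -
  let ?R = "return \<union> (same_exit \<inter> (return O return\<inverse>))"
  have "(a, b) \<in> slice (\<lambda>_. \<Gamma>) \<longleftrightarrow> (a, b) \<in> ?R" for a b
  proof (cases "a \<in> exits")
    case True
    then obtain i where i: "i \<in> {1..m}" and a: "a \<in> exit i" by (auto simp: exits_def)
    show ?thesis
      unfolding same_line_iff_return[OF a i] slice_iff[OF a i] using tuples_mem[OF _ i] by blast
  next
    case False
    then show ?thesis by (auto simp: slice_def return_def exits_def)
  qed
  then have "slice (\<lambda>_. \<Gamma>) = ?R" by (intro set_eqI) (simp only: split_paired_all)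
  moreover have "cc_relation Z ?R"
    by (intro Z.relation_Un Z.relation_Int Z.relation_relcomp Z.relation_converse
        relation_return relation_same_exit)
  ultimately show ?thesis by simp
qed

lemma ex_other_point:
  assumes "i \<in> {1..m}"
  shows "\<exists>y\<in>\<Gamma>. y \<noteq> x"
proof -
  obtain y z where "y \<in> Q i" "z \<in> \<Gamma> - Q i" using Q_nonempty[OF assms] Q_proper[OF assms] by blast
  then have "y \<in> \<Gamma>" "z \<in> \<Gamma>" "y \<noteq> z" using Q_subset[OF assms] by auto
  then show ?thesis by metis
qed

lemma relation_slice:
  assumes w: "\<And>i. i \<in> {1..m} \<Longrightarrow> w i \<subseteq> \<Gamma> \<and> w i \<noteq> {}" and W: "cc_set Z (PiE {1..m} w)"
  shows "cc_relation Z (slice w)"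
proof -
  let ?F = "slice (\<lambda>_. \<Gamma>)" and ?W = "towards (PiE {1..m} w)"
  have "slice w = ?F \<inter> (?F O ?W)"
  proof (intro equalityI subrelI)
    fix a b assume "(a, b) \<in> slice w"
    then obtain i where i: "i \<in> {1..m}" and a: "a \<in> exit i"
      and b: "b \<in> tuples m \<Gamma>" "same_line i a b" "b i \<in> w i" by (rule sliceE)
    obtain y where y: "y \<in> \<Gamma>" "y \<noteq> b i" using ex_other_point[OF i] by blast
    let ?d = "b(i := y)"
    have d: "?d \<in> tuples m \<Gamma>" "same_line i ?d b"
      by (rule tuples_upd[OF b(1) i y(1)], rule same_line_sym[OF same_line_upd])
    then have "(a, ?d) \<in> ?F"
      using slice_iff[OF a i] y(1) same_line_trans[OF b(2) same_line_upd] by simp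
    moreover have "(?d, b) \<in> ?W"
      using towards_PiE_iff[of w] w d b i y(2) by (auto intro!: bexI[of _ i])
    moreover have "(a, b) \<in> ?F" using slice_iff[OF a i] b w[OF i] by blast
    ultimately show "(a, b) \<in> ?F \<inter> (?F O ?W)" by blast
  next
    fix a b assume "(a, b) \<in> ?F \<inter> (?F O ?W)"
    then obtain d where ab: "(a, b) \<in> ?F" and ad: "(a, d) \<in> ?F" and "(d, b) \<in> ?W" by blast
    then obtain j where j: "same_line j d b" "d j \<noteq> b j" "b j \<in> w j"
      using towards_PiE_iff[of w] w by blast
    obtain i where i: "i \<in> {1..m}" and a: "a \<in> exit i" using ab by (rule sliceE)
    have b: "b \<in> tuples m \<Gamma>" "same_line i a b" using ab slice_iff[OF a i] by blast+
    have "same_line i d b"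
      using ad slice_iff[OF a i] same_line_trans[OF same_line_sym b(2)] by blast
    then have "j = i" using same_line_unique[OF j(1) _ j(2)] by blast
    then show "(a, b) \<in> slice w" unfolding slice_iff[OF a i] using b j(3) by blast
  qed
  moreover have "cc_relation Z (?F \<inter> (?F O ?W))"
    by (intro Z.relation_Int Z.relation_relcomp relation_slice_full relation_towards W)
  ultimately show ?thesis by simp
qed

lemma relation_slice_set:
  assumes "cc_set T P"
  shows "cc_relation Z (slice (\<lambda>_. P))"
proof (cases "P = {}")
  case True
  then show ?thesis using Z.relation_empty by (simp add: slice_def)
next
  case False
  then show ?thesis by (intro relation_slice set_power[OF assms] conjI Y.set_subset[OF assms])
qed

section \<open>Sets of indices determined by product sets\<close>

lemma card_slice_Image:
  assumes w: "w i \<subseteq> \<Gamma>" and a: "a \<in> exit i" and i: "i \<in> {1..m}"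
  shows "card (slice w `` {a}) = card (w i)"
proof -
  have "slice w `` {a} = (\<lambda>x. a(i := x)) ` w i"
  proof (intro equalityI subsetI)
    fix b assume "b \<in> slice w `` {a}"
    then show "b \<in> (\<lambda>x. a(i := x)) ` w i"
      using slice_iff[OF a i] same_line_iff_upd by (metis Image_singleton_iff imageI)
  qed (use w slice_upd[OF a i] in blast)
  moreover have "inj_on (\<lambda>x. a(i := x)) (w i)" by (rule inj_onI) (metis fun_upd_same)
  ultimately show ?thesis by (simp add: card_image)
qed

lemma set_exits_card:
  assumes w: "\<And>i. i \<in> {1..m} \<Longrightarrow> w i \<subseteq> \<Gamma> \<and> w i \<noteq> {}" and W: "cc_set Z (PiE {1..m} w)"
  shows "cc_set Z (\<Union>i\<in>{i \<in> {1..m}. P (card (w i))}. exit i)"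
proof -
  have "card (slice w `` {a}) = card (w i)" if "i \<in> {1..m}" "a \<in> exit i" for a i
    using card_slice_Image that w by blast
  then have "(\<Union>i\<in>{i \<in> {1..m}. P (card (w i))}. exit i)
      = exits \<inter> {a \<in> tuples m \<Gamma>. P (card (slice w `` {a}))}"
    using exit_tuples unfolding exits_def by fastforce
  then show ?thesis
    using Z.set_Int[OF set_exits Z.set_degree[OF relation_slice[OF w W]]] by simp
qed

lemma set_exits_type_irrefl:
  assumes R: "cc_relation T R" and irrefl: "\<And>x. (x, x) \<notin> R"
    and v: "\<And>i. i \<in> {1..m} \<Longrightarrow> v i \<subseteq> \<Gamma>" "cc_relation Z (slice v)"
    and w: "\<And>i. i \<in> {1..m} \<Longrightarrow> w i \<subseteq> \<Gamma>" "cc_relation Z (slice w)"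
  shows "cc_set Z (\<Union>i\<in>{i \<in> {1..m}. v i \<times> w i \<inter> R \<noteq> {}}. exit i)"
proof -
  let ?P = "slice v \<inter> (slice w O (step R)\<inverse>)"
  have "(\<Union>i\<in>{i \<in> {1..m}. v i \<times> w i \<inter> R \<noteq> {}}. exit i) = Domain ?P"
  proof (intro equalityI subsetI)
    fix a assume "a \<in> (\<Union>i\<in>{i \<in> {1..m}. v i \<times> w i \<inter> R \<noteq> {}}. exit i)"
    then obtain i x y where i: "i \<in> {1..m}" and a: "a \<in> exit i"
      and xy: "x \<in> v i" "y \<in> w i" "(x, y) \<in> R"
      by blast
    then have "(a, a(i := x)) \<in> slice v" "(a, a(i := y)) \<in> slice w"
      using slice_upd v(1) w(1) by blast+
    moreover from this have "(a(i := x), a(i := y)) \<in> step R"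
      using xy(3) i unfolding step_def by (auto simp: slice_def same_line_def intro!: bexI[of _ i])
    ultimately show "a \<in> Domain ?P" by blast
  next
    fix a assume "a \<in> Domain ?P"
    then obtain b c where bc: "(a, b) \<in> slice v" "(a, c) \<in> slice w" "(b, c) \<in> step R" by blast
    obtain i where i: "i \<in> {1..m}" and a: "a \<in> exit i" using bc(1) by (rule sliceE)
    have ab: "same_line i a b" "b i \<in> v i" and ac: "same_line i a c" "c i \<in> w i"
      using bc by (simp_all add: slice_iff[OF a i])
    obtain j where j: "same_line j b c" "(b j, c j) \<in> R" using bc(3) by (auto simp: step_def)
    moreover have "b j \<noteq> c j" using j(2) irrefl by metis
    ultimately have "i = j" using same_line_unique same_line_common[OF ab(1) ac(1)] by metis
    then show "a \<in> (\<Union>i\<in>{i \<in> {1..m}. v i \<times> w i \<inter> R \<noteq> {}}. exit i)"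
      using i a j(2) ab(2) ac(2) by blast
  qed
  moreover have "cc_relation Z ?P"
    by (intro Z.relation_Int Z.relation_relcomp Z.relation_converse relation_step R v w)
  ultimately show ?thesis using Z.set_Domain by simp
qed

lemma set_exits_type_Id:
  assumes P: "cc_set T P" and v: "cc_relation Z (slice v)" and w: "cc_relation Z (slice w)"
  shows "cc_set Z (\<Union>i\<in>{i \<in> {1..m}. v i \<times> w i \<inter> Id_on P \<noteq> {}}. exit i)"
proof -
  have "(\<Union>i\<in>{i \<in> {1..m}. v i \<times> w i \<inter> Id_on P \<noteq> {}}. exit i)
      = Domain (slice v \<inter> slice w \<inter> slice (\<lambda>_. P))"
  proof (intro equalityI subsetI)
    fix a assume "a \<in> (\<Union>i\<in>{i \<in> {1..m}. v i \<times> w i \<inter> Id_on P \<noteq> {}}. exit i)"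
    then obtain i x where "i \<in> {1..m}" "a \<in> exit i" "x \<in> v i" "x \<in> w i" "x \<in> P" by auto
    moreover from this have "x \<in> \<Gamma>" using Y.set_subset[OF P] by blast
    ultimately have "(a, a(i := x)) \<in> slice v \<inter> slice w \<inter> slice (\<lambda>_. P)"
      using slice_upd[of a i x] by simp
    then show "a \<in> Domain (slice v \<inter> slice w \<inter> slice (\<lambda>_. P))" by blast
  next
    fix a assume "a \<in> Domain (slice v \<inter> slice w \<inter> slice (\<lambda>_. P))"
    then obtain b where b: "(a, b) \<in> slice v" "(a, b) \<in> slice w" "(a, b) \<in> slice (\<lambda>_. P)" by blast
    obtain i where i: "i \<in> {1..m}" and a: "a \<in> exit i" using b(1) by (rule sliceE)
    have "b i \<in> v i" "b i \<in> w i" "b i \<in> P" using b by (simp_all add: slice_iff[OF a i])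
    then have "v i \<times> w i \<inter> Id_on P \<noteq> {}" by blast
    then show "a \<in> (\<Union>i\<in>{i \<in> {1..m}. v i \<times> w i \<inter> Id_on P \<noteq> {}}. exit i)" using i a by blast
  qed
  then show ?thesis
    using Z.set_Domain[OF Z.relation_Int[OF Z.relation_Int[OF v w] relation_slice_set[OF P]]]
    by simp
qed

lemma set_exits_type:
  assumes R: "cc_relation T R"
    and v: "\<And>i. i \<in> {1..m} \<Longrightarrow> v i \<subseteq> \<Gamma>" "cc_relation Z (slice v)"
    and w: "\<And>i. i \<in> {1..m} \<Longrightarrow> w i \<subseteq> \<Gamma>" "cc_relation Z (slice w)"
  shows "cc_set Z (\<Union>i\<in>{i \<in> {1..m}. v i \<times> w i \<inter> R \<noteq> {}}. exit i)"
proof -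
  let ?P = "{x. (x, x) \<in> R}"
  have R': "cc_relation T (R - Id_on \<Gamma>)" by (rule Y.relation_Diff[OF R Y.relation_Id])
  have irrefl: "(x, x) \<notin> R - Id_on \<Gamma>" for x using Y.relation_subset[OF R] by auto
  have "v i \<times> w i \<inter> R \<noteq> {} \<longleftrightarrow> v i \<times> w i \<inter> Id_on ?P \<noteq> {} \<or> v i \<times> w i \<inter> (R - Id_on \<Gamma>) \<noteq> {}" for i
    unfolding Y.Id_on_loops[OF R] by blast
  then have "{i \<in> {1..m}. v i \<times> w i \<inter> R \<noteq> {}} = {i \<in> {1..m}. v i \<times> w i \<inter> Id_on ?P \<noteq> {}}
      \<union> {i \<in> {1..m}. v i \<times> w i \<inter> (R - Id_on \<Gamma>) \<noteq> {}}"
    by (simp only: conj_disj_distribL Collect_disj_eq)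
  then show ?thesis
    using Z.set_Un[OF set_exits_type_Id[OF Y.set_loops[OF R] v(2) w(2)]
        set_exits_type_irrefl[OF R' irrefl v w]]
    by (simp only: UN_Un)
qed

end

section \<open>The fission induced on the indices\<close>

context exp_box
begin

definition exit_index :: "(nat \<Rightarrow> 'a) \<Rightarrow> nat" where
  "exit_index a = (THE i. i \<in> {1..m} \<and> a \<in> exit i)"

lemma exit_index_eq: "a \<in> exit i \<Longrightarrow> i \<in> {1..m} \<Longrightarrow> exit_index a = i"
  unfolding exit_index_def using exit_unique by blast

lemma exits_iff: "a \<in> exits \<longleftrightarrow> exit_index a \<in> {1..m} \<and> a \<in> exit (exit_index a)"
  unfolding exits_def using exit_index_eq by auto

lemma UN_exit_iff: "D \<subseteq> {1..m} \<Longrightarrow> a \<in> (\<Union>i\<in>D. exit i) \<longleftrightarrow> a \<in> exits \<and> exit_index a \<in> D"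
  unfolding exits_def using exit_index_eq by blast

lemma exit_index_image: "exit_index ` exits = {1..m}"
proof (intro equalityI subsetI)
  fix i assume i: "i \<in> {1..m}"
  then obtain a where "a \<in> exit i" using exit_nonempty by blast
  then show "i \<in> exit_index ` exits" using i exit_index_eq[of a i] unfolding exits_def by blast
qed (auto simp: exits_iff)

abbreviation index_pullback :: "nat rel \<Rightarrow> (nat \<Rightarrow> 'a) rel" where
  "index_pullback \<equiv> pullback (exits \<times> exits) exit_index"

lemma same_exit_eq: "same_exit = index_pullback Id"
proof (intro equalityI subrelI)
  fix a b assume "(a, b) \<in> same_exit"
  then obtain i where "i \<in> {1..m}" "a \<in> exit i" "b \<in> exit i" by (auto simp: same_exit_def)
  then show "(a, b) \<in> index_pullback Id"
    using exit_index_eq unfolding pullback_def exits_def by auto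
next
  fix a b assume "(a, b) \<in> index_pullback Id"
  then show "(a, b) \<in> same_exit" by (auto simp: pullback_def exits_iff same_exit_def)
qed

lemma relation_index_pullback_image:
  assumes "W \<subseteq> exits \<times> exits" "cc_relation Z W"
  shows "cc_relation Z (index_pullback (map_prod exit_index exit_index ` W))"
proof -
  have "index_pullback (map_prod exit_index exit_index ` W) = same_exit O W O same_exit"
  proof (intro equalityI subrelI)
    fix a b assume "(a, b) \<in> index_pullback (map_prod exit_index exit_index ` W)"
    then obtain c d where "a \<in> exits" "b \<in> exits" "(c, d) \<in> W"
      "exit_index a = exit_index c" "exit_index d = exit_index b"
      by (auto simp: pullback_def)
    moreover from this have "(a, c) \<in> same_exit" "(d, b) \<in> same_exit"
      using assms(1) unfolding same_exit_eq by (auto simp: pullback_def)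
    ultimately show "(a, b) \<in> same_exit O W O same_exit" by blast
  next
    fix a b assume "(a, b) \<in> same_exit O W O same_exit"
    then obtain c d where "(c, d) \<in> W" "(a, c) \<in> same_exit" "(d, b) \<in> same_exit" by blast
    then show "(a, b) \<in> index_pullback (map_prod exit_index exit_index ` W)"
      unfolding same_exit_eq by (force simp: pullback_def)
  qed
  then show ?thesis using assms(2) by (simp add: Z.relation_relcomp relation_same_exit)
qed

definition crossing :: "'a rel \<Rightarrow> 'a rel \<Rightarrow> (nat \<Rightarrow> 'a) rel" where
  "crossing u v = exits \<times> exits \<inter> ((return \<inter> step u) O (return\<inverse> \<inter> step v)) - same_exit"

lemma relation_crossing: "cc_relation T u \<Longrightarrow> cc_relation T v \<Longrightarrow> cc_relation Z (crossing u v)"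
  unfolding crossing_def
  by (intro Z.relation_Diff Z.relation_Int Z.relation_Times Z.relation_relcomp Z.relation_converse
      set_exits relation_return relation_step relation_same_exit)

lemma crossing_iff:
  assumes a: "a \<in> exit i" and b: "b \<in> exit j" and i: "i \<in> {1..m}" and j: "j \<in> {1..m}"
  shows "(a, b) \<in> crossing u v \<longleftrightarrow>
    i \<noteq> j \<and> (a i, b i) \<in> u \<and> (a j, b j) \<in> v \<and> (\<forall>k\<in>{1..m} - {i, j}. a k = b k)"
proof -
  have iff: "(a, b) \<in> crossing u v \<longleftrightarrow>
      i \<noteq> j \<and> (\<exists>q\<in>box. same_line i a q \<and> (a i, q i) \<in> u \<and> same_line j q b \<and> (q j, b j) \<in> v)"
  proof -
    have "(a, b) \<in> exits \<times> exits" using a b i j by (auto simp: exits_def)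
    then have "(a, b) \<in> crossing u v \<longleftrightarrow>
        i \<noteq> j \<and> (\<exists>q. (a, q) \<in> return \<inter> step u \<and> (q, b) \<in> return\<inverse> \<inter> step v)"
      unfolding crossing_def relcomp_unfold using same_exit_iff[OF a b i j] by auto
    then show ?thesis unfolding return_step_iff(1)[OF a i] return_step_iff(2)[OF b j] by blast
  qed
  show ?thesis
    unfolding iff
  proof (intro iffI; elim conjE bexE)
    fix q assume "i \<noteq> j" "same_line i a q" "(a i, q i) \<in> u" "same_line j q b" "(q j, b j) \<in> v"
    then show "i \<noteq> j \<and> (a i, b i) \<in> u \<and> (a j, b j) \<in> v \<and> (\<forall>k\<in>{1..m} - {i, j}. a k = b k)"
      by (auto simp: same_line_def)
  next
    assume ij: "i \<noteq> j" and u: "(a i, b i) \<in> u" and v: "(a j, b j) \<in> v"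
      and eq: "\<forall>k\<in>{1..m} - {i, j}. a k = b k"
    let ?q = "a(i := b i)"
    have q: "?q \<in> box" using box_upd[OF exit_tube[OF a] i] exit_entry[OF b i] ij by simp
    then have "same_line j ?q b"
      using exit_tuples[OF b] eq by (intro same_line_tuplesI[of _ m \<Gamma>]) (auto simp: box_def)
    then show "i \<noteq> j \<and> (\<exists>q\<in>box. same_line i a q \<and> (a i, q i) \<in> u \<and> same_line j q b \<and> (q j, b j) \<in> v)"
      using ij u v q same_line_upd[of i a "b i"] by (intro conjI bexI[of _ ?q]) auto
  qed
qed

text \<open>Two different types at the positions \<open>i\<close> and \<open>j\<close> tell the two positions apart, so the orbit of
  the ordered pair \<open>(i, j)\<close> becomes visible.\<close>

definition orbital :: "nat \<Rightarrow> nat \<Rightarrow> 'a rel \<Rightarrow> 'a rel \<Rightarrow> (nat \<Rightarrow> 'a) rel" where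
  "orbital i j u v = sym_tensor m \<Gamma> L (\<lambda>k. if k = i then u else if k = j then v else Id_on \<Gamma>)"

lemma relation_orbital: "cc_relation T u \<Longrightarrow> cc_relation T v \<Longrightarrow> cc_relation Z (orbital i j u v)"
  unfolding orbital_def by (rule relation_sym_tensor) (simp add: Y.relation_Id)

lemma orbitalI:
  assumes l: "l \<in> L" and ab: "a \<in> tuples m \<Gamma>" "b \<in> tuples m \<Gamma>" and ij: "i \<noteq> j"
    and types: "(a (l i), b (l i)) \<in> u" "(a (l j), b (l j)) \<in> v"
    and eq: "\<And>k. k \<noteq> l i \<Longrightarrow> k \<noteq> l j \<Longrightarrow> a k = b k"
  shows "(a, b) \<in> orbital i j u v"
proof -
  have "(a (l k), b (l k)) \<in> (if k = i then u else if k = j then v else Id_on \<Gamma>)"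
    if k: "k \<in> {1..m}" for k
  proof (cases "k = i \<or> k = j")
    case True
    then show ?thesis using types ij by auto
  next
    case False
    then have "a (l k) = b (l k)"
      using eq permutes_inj[OF permutes[OF l]] by (auto dest: injD)
    then show ?thesis using False tuples_mem[OF ab(1) perm_mem[OF l k]] by (simp add: Id_on_iff)
  qed
  then show ?thesis unfolding orbital_def sym_tensor_iff[OF group] using l ab by blast
qed

lemma crossing_orbitalE:
  assumes ab: "(a, b) \<in> crossing u v" "(a, b) \<in> orbital i j u v" and disjoint: "u \<inter> v = {}"
  obtains l where "l \<in> L" "exit_index a = l i" "exit_index b = l j"
proof -
  let ?x = "exit_index a" and ?y = "exit_index b"
  have x: "?x \<in> {1..m}" "a \<in> exit ?x" and y: "?y \<in> {1..m}" "b \<in> exit ?y"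
    using ab(1) exits_iff unfolding crossing_def by blast+
  have cross: "?x \<noteq> ?y" "(a ?x, b ?x) \<in> u" "(a ?y, b ?y) \<in> v"
    using ab(1) crossing_iff[OF x(2) y(2) x(1) y(1)] by blast+
  have differ: "a ?x \<noteq> b ?x" "a ?y \<noteq> b ?y"
    using x y exit_entry[OF y(2) x(1)] exit_entry[OF x(2) y(1)] cross(1) unfolding exit_def by auto
  obtain l where l: "l \<in> L"
    and types: "\<forall>k\<in>{1..m}. (a (l k), b (l k)) \<in> (if k = i then u else if k = j then v else Id_on \<Gamma>)"
    using ab(2) unfolding orbital_def by (rule sym_tensorE)
  have "?x \<in> l ` {1..m}" "?y \<in> l ` {1..m}"
    unfolding permutes_image[OF permutes[OF l]] by (rule x(1), rule y(1))
  then obtain k k' where k: "k \<in> {1..m}" "?x = l k" and k': "k' \<in> {1..m}" "?y = l k'" by blast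
  have "k = i \<or> k = j" using bspec[OF types k(1)] differ(1) k(2) by (auto split: if_splits)
  then have "k = i" using bspec[OF types k(1)] cross(2) disjoint k(2) by (auto split: if_splits)
  moreover have "k' = i \<or> k' = j"
    using bspec[OF types k'(1)] differ(2) k'(2) by (auto split: if_splits)
  ultimately have "?x = l i" "?y = l j" using k(2) k'(2) cross(1) by auto
  then show ?thesis by (rule that[OF l])
qed

lemma ex_distinct_crossing_types:
  assumes i: "i \<in> {1..m}" and j: "j \<in> {1..m}"
  obtains u v c c' d d' where "u \<in> T" "v \<in> T" "u \<inter> v = {}" "c \<in> \<Gamma> - Q i" "c' \<in> Q i" "(c, c') \<in> u"
    "d \<in> \<Gamma> - Q j" "d' \<in> Q j" "(d', d) \<in> v"
proof -
  obtain c0 c0' where c0: "c0 \<in> \<Gamma> - Q i" "c0' \<in> Q i" using Q_proper[OF i] Q_nonempty[OF i] by blast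
  obtain d0 d0' where d0: "d0 \<in> \<Gamma> - Q j" "d0' \<in> Q j" using Q_proper[OF j] Q_nonempty[OF j] by blast
  have Q: "Q i \<subseteq> \<Gamma>" "Q j \<subseteq> \<Gamma>" using Q_subset i j by blast+
  obtain v0 where v0: "v0 \<in> T" "(d0', d0) \<in> v0" using Y.ex_basic[of d0' d0] d0 Q by blast
  have "\<exists>c c' d d'. c \<in> \<Gamma> - Q i \<and> c' \<in> Q i \<and> d \<in> \<Gamma> - Q j \<and> d' \<in> Q j \<and>
      (\<forall>t\<in>T. \<not> ((c, c') \<in> t \<and> (d', d) \<in> t))"
  proof (cases "(\<Gamma> - Q i) \<times> Q i \<subseteq> v0")
    case True
    then obtain d d' where "d \<in> \<Gamma> - Q j" "d' \<in> Q j" "(d', d) \<notin> v0"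
      using Q_crossing[OF i j v0(1)] by blast
    then show ?thesis using True c0 Y.basic_unique[OF v0(1)] by blast
  next
    case False
    then obtain c c' where "c \<in> \<Gamma> - Q i" "c' \<in> Q i" "(c, c') \<notin> v0" by blast
    then show ?thesis using v0 d0 Y.basic_unique[OF v0(1)] by blast
  qed
  then obtain c c' d d' where c: "c \<in> \<Gamma> - Q i" "c' \<in> Q i" and d: "d \<in> \<Gamma> - Q j" "d' \<in> Q j"
    and distinct: "\<forall>t\<in>T. \<not> ((c, c') \<in> t \<and> (d', d) \<in> t)" by blast
  obtain u where u: "u \<in> T" "(c, c') \<in> u" using Y.ex_basic[of c c'] c Q by blast
  obtain v where v: "v \<in> T" "(d', d) \<in> v" using Y.ex_basic[of d' d] d Q by blast
  have "u \<inter> v = {}" using Y.basic_unique[OF u(1) v(1)] distinct u v by blast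
  then show ?thesis using that u v c d by blast
qed

lemma ex_crossing_orbital:
  assumes l: "l \<in> L" and i: "i \<in> {1..m}" and j: "j \<in> {1..m}" and ij: "i \<noteq> j"
  obtains u v a b where "u \<in> T" "v \<in> T" "u \<inter> v = {}"
    "(a, b) \<in> crossing u v" "(a, b) \<in> orbital i j u v" "exit_index a = l i" "exit_index b = l j"
proof -
  let ?x = "l i" and ?y = "l j"
  have x: "?x \<in> {1..m}" and y: "?y \<in> {1..m}" using perm_mem l i j by auto
  have xy: "?x \<noteq> ?y" using ij permutes_inj[OF permutes[OF l]] by (auto dest: injD)
  obtain u v c c' d d' where uv: "u \<in> T" "v \<in> T" "u \<inter> v = {}"
    and c: "c \<in> \<Gamma> - Q ?x" "c' \<in> Q ?x" "(c, c') \<in> u" and d: "d \<in> \<Gamma> - Q ?y" "d' \<in> Q ?y" "(d', d) \<in> v"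
    by (rule ex_distinct_crossing_types[OF x y])
  obtain q0 where "q0 \<in> box" using box_nonempty by blast
  define q where "q = q0(?x := c', ?y := d')"
  have q: "q \<in> box"
    unfolding q_def using box_upd[OF _ x c(2)] box_upd[OF _ y d(2)] box_subset_tube \<open>q0 \<in> box\<close>
    by blast
  define a b where "a = q(?x := c)" and "b = q(?y := d)"
  have a: "a \<in> exit ?x" and b: "b \<in> exit ?y"
    using c d q box_subset_tube[of ?x] box_subset_tube[of ?y] x y tube_upd[of q]
    unfolding exit_def a_def b_def by auto
  have types: "(a ?x, b ?x) \<in> u" "(a ?y, b ?y) \<in> v" and eq: "\<And>k. k \<noteq> ?x \<Longrightarrow> k \<noteq> ?y \<Longrightarrow> a k = b k"
    using c(3) d(3) xy by (auto simp: q_def a_def b_def)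
  then have "(a, b) \<in> crossing u v" using crossing_iff[OF a b x y] xy by blast
  moreover have "(a, b) \<in> orbital i j u v"
    by (rule orbitalI[OF l exit_tuples[OF a] exit_tuples[OF b] ij types eq])
  ultimately show ?thesis by (rule that[OF uv _ _ exit_index_eq[OF a x] exit_index_eq[OF b y]])
qed

lemma orbital_diagonal: "i \<in> {1..m} \<Longrightarrow> {(l i, l i) | l. l \<in> L} = Id_on {1..m}"
  using transitive perm_mem unfolding transitive_on_def by (fastforce simp: Id_on_iff)

lemma relation_index_pullback_orbit:
  assumes i: "i \<in> {1..m}" and j: "j \<in> {1..m}"
  shows "cc_relation Z (index_pullback {(l i, l j) | l. l \<in> L})"
proof (cases "i = j")
  case True
  have "index_pullback (Id_on {1..m}) = same_exit"
    unfolding same_exit_eq by (auto simp: pullback_def exits_iff)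
  then show ?thesis using orbital_diagonal[OF i] True relation_same_exit by simp
next
  case False
  define W where "W = (\<Union>(u, v)\<in>{(u, v) \<in> T \<times> T. u \<inter> v = {}}. crossing u v \<inter> orbital i j u v)"
  have "cc_relation Z W"
    unfolding W_def
    using Z.relation_Int[OF relation_crossing relation_orbital] cc_relation_basic[of _ T]
    by (intro cc_relation_UN) auto
  moreover have "W \<subseteq> exits \<times> exits" by (auto simp: W_def crossing_def)
  ultimately have "cc_relation Z (index_pullback (map_prod exit_index exit_index ` W))"
    by (intro relation_index_pullback_image)
  also have "map_prod exit_index exit_index ` W = {(l i, l j) | l. l \<in> L}"
  proof (intro equalityI subrelI)
    fix x y assume "(x, y) \<in> map_prod exit_index exit_index ` W"
    then obtain a b u v where "x = exit_index a" "y = exit_index b" "u \<inter> v = {}"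
      "(a, b) \<in> crossing u v" "(a, b) \<in> orbital i j u v" by (auto simp: W_def)
    then show "(x, y) \<in> {(l i, l j) | l. l \<in> L}" using crossing_orbitalE by blast
  next
    fix x y assume "(x, y) \<in> {(l i, l j) | l. l \<in> L}"
    then obtain l where "l \<in> L" "x = l i" "y = l j" by blast
    obtain u v a b where "u \<in> T" "v \<in> T" "u \<inter> v = {}"
      "(a, b) \<in> crossing u v" "(a, b) \<in> orbital i j u v" "exit_index a = l i" "exit_index b = l j"
      by (rule ex_crossing_orbital[OF \<open>l \<in> L\<close> i j False])
    then have "(a, b) \<in> W" "(x, y) = map_prod exit_index exit_index (a, b)"
      using \<open>x = l i\<close> \<open>y = l j\<close> by (auto simp: W_def)
    then show "(x, y) \<in> map_prod exit_index exit_index ` W" by (metis imageI)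
  qed
  finally show ?thesis .
qed

lemma coherent_quotient_exits:
  assumes "m > 0"
  shows "coherent_quotient (tuples m \<Gamma>) Z (exits \<times> exits) exit_index {1..m}"
proof
  show "cc_relation Z (exits \<times> exits)" by (rule Z.relation_Times[OF set_exits set_exits])
  show "cc_relation Z (index_pullback Id)"
    using relation_same_exit by (simp add: same_exit_eq)
  show "exit_index ` ((exits \<times> exits) `` {a}) = {1..m}" if "a \<in> Domain (exits \<times> exits)" for a
  proof -
    have "(exits \<times> exits) `` {a} = exits" using that by auto
    then show ?thesis using exit_index_image by simp
  qed
  show "exits \<times> exits \<noteq> {}" using exit_index_image assms by (auto simp: atLeastAtMost_iff)
qed (auto simp: sym_def trans_def pullback_def)

lemma set_exit_if_base:
  assumes base: "generalized_base {1..m} (Inv_rels m L) DD"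
    and DD: "\<And>D. D \<in> DD \<Longrightarrow> cc_set Z (\<Union>i\<in>D. exit i)" and i: "i \<in> {1..m}"
  shows "cc_set Z (exit i)"
proof -
  have "m > 0" using i by (simp add: atLeastAtMost_iff)
  have "cc_relation Z (index_pullback (Id_on {i}))"
  proof (rule coherent_quotient.relation_lift_singleton[OF coherent_quotient_exits[OF \<open>m > 0\<close>] base
        Inv_rels_subset[OF group] _ _ i])
    show "cc_relation Z (index_pullback s)" if "s \<in> Inv_rels m L" for s
      using that relation_index_pullback_orbit unfolding Inv_rels_def by blast
    fix D assume D: "D \<in> DD"
    then have "D \<subseteq> {1..m}" using base by (auto simp: generalized_base_def)
    then have "index_pullback (Id_on D) = same_exit \<inter> (\<Union>i\<in>D. exit i) \<times> (\<Union>i\<in>D. exit i)"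
      unfolding same_exit_eq pullback_def using UN_exit_iff by (auto simp only: Id_on_iff; simp)
    then show "cc_relation Z (index_pullback (Id_on D))"
      using Z.relation_restrict[OF DD[OF D] relation_same_exit DD[OF D]] by simp
  qed
  moreover have "Domain (index_pullback (Id_on {i})) = exit i"
    using i exit_index_eq[of _ i] by (auto simp: pullback_def exits_iff)
  ultimately show ?thesis using Z.set_Domain by metis
qed

end

section \<open>The fissions induced on the coordinates\<close>

locale exp_split = exp_box +
  assumes set_exit: "\<And>i. i \<in> {1..m} \<Longrightarrow> cc_set Z (exit i)"
begin

definition tube_line :: "nat \<Rightarrow> (nat \<Rightarrow> 'a) rel" where
  "tube_line i = {(a, b). a \<in> tube i \<and> b \<in> tube i \<and> same_line i a b}"

lemma tube_exitE:
  assumes "b \<in> tube i" "i \<in> {1..m}"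
  obtains a where "a \<in> exit i" "same_line i a b"
proof -
  obtain y where "y \<in> \<Gamma> - Q i" using Q_proper[OF assms(2)] by blast
  then have "b(i := y) \<in> exit i" using tube_upd[OF assms] by (simp add: exit_def)
  then show ?thesis by (rule that) (rule same_line_sym[OF same_line_upd])
qed

lemma relation_tube_line:
  assumes i: "i \<in> {1..m}"
  shows "cc_relation Z (tube_line i)"
proof -
  let ?R = "slice (\<lambda>_. \<Gamma>) \<inter> exit i \<times> tuples m \<Gamma>"
  have R_iff: "(a, b) \<in> ?R \<longleftrightarrow> a \<in> exit i \<and> b \<in> tube i \<and> same_line i a b" for a b
  proof (cases "a \<in> exit i")
    case True
    then show ?thesis
      using tuples_mem[OF _ i, of b \<Gamma>] tube_tuples[of b i] tube_same_line[OF exit_tube[OF True]]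
      unfolding Int_iff slice_iff[OF True i] by blast
  qed simp
  have "tube_line i = ?R\<inverse> O ?R"
  proof (intro equalityI subrelI)
    fix b c assume bc: "(b, c) \<in> tube_line i"
    then obtain a where "a \<in> exit i" "same_line i a b"
      using tube_exitE[OF _ i] by (auto simp: tube_line_def)
    then have "(a, b) \<in> ?R" "(a, c) \<in> ?R"
      unfolding R_iff using bc same_line_trans by (auto simp: tube_line_def)
    then show "(b, c) \<in> ?R\<inverse> O ?R" by blast
  next
    fix b c assume "(b, c) \<in> ?R\<inverse> O ?R"
    then obtain a where "(a, b) \<in> ?R" "(a, c) \<in> ?R" by blast
    then show "(b, c) \<in> tube_line i"
      unfolding R_iff using same_line_common by (auto simp: tube_line_def)
  qed
  moreover have "cc_relation Z ?R"
    by (rule Z.relation_restrict[OF set_exit[OF i] relation_slice_full Z.set_full])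
  ultimately show ?thesis by (simp add: Z.relation_relcomp Z.relation_converse)
qed

lemma set_tube_slice:
  assumes i: "i \<in> {1..m}" and w: "cc_relation Z (slice w)" "w i \<subseteq> \<Gamma>"
  shows "cc_set Z {b \<in> tube i. b i \<in> w i}"
proof -
  have "{b \<in> tube i. b i \<in> w i} = Range (slice w \<inter> exit i \<times> tuples m \<Gamma>)"
  proof (intro equalityI subsetI)
    fix b assume b: "b \<in> {b \<in> tube i. b i \<in> w i}"
    then obtain a where a: "a \<in> exit i" "same_line i a b" using tube_exitE[OF _ i] by blast
    then have "(a, b) \<in> slice w" using b tube_tuples[of b i] by (simp add: slice_iff[OF a(1) i])
    then show "b \<in> Range (slice w \<inter> exit i \<times> tuples m \<Gamma>)" using a b tube_tuples by blast
  next
    fix b assume "b \<in> Range (slice w \<inter> exit i \<times> tuples m \<Gamma>)"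
    then obtain a where a: "a \<in> exit i" and "(a, b) \<in> slice w" by blast
    then show "b \<in> {b \<in> tube i. b i \<in> w i}"
      using tube_same_line[OF exit_tube[OF a]] by (simp add: slice_iff[OF a i])
  qed
  then show ?thesis
    using Z.set_Range[OF Z.relation_restrict[OF set_exit[OF i] w(1) Z.set_full]] by simp
qed

lemma set_tube_set: "i \<in> {1..m} \<Longrightarrow> cc_set T P \<Longrightarrow> cc_set Z {b \<in> tube i. b i \<in> P}"
  using set_tube_slice[of i "\<lambda>_. P"] relation_slice_set Y.set_subset by blast

abbreviation tube_pullback :: "nat \<Rightarrow> 'a rel \<Rightarrow> (nat \<Rightarrow> 'a) rel" where
  "tube_pullback i \<equiv> pullback (tube_line i) (\<lambda>a. a i)"

lemma tube_pullback_Id_on: "tube_pullback i (Id_on P) = Id_on {b \<in> tube i. b i \<in> P}"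
proof (intro equalityI subrelI)
  fix a b assume "(a, b) \<in> tube_pullback i (Id_on P)"
  then have "a = b" "a \<in> tube i" "a i \<in> P"
    by (auto simp: pullback_def tube_line_def same_line_def fun_eq_iff) metis
  then show "(a, b) \<in> Id_on {b \<in> tube i. b i \<in> P}" by (simp add: Id_on_iff)
qed (auto simp: pullback_def tube_line_def same_line_def)

lemma relation_tube_pullback:
  assumes i: "i \<in> {1..m}" and R: "cc_relation T R"
  shows "cc_relation Z (tube_pullback i R)"
proof -
  let ?P = "{x. (x, x) \<in> R}"
  have "cc_relation Z (tube_pullback i (Id_on ?P))"
    unfolding tube_pullback_Id_on using set_tube_set[OF i Y.set_loops[OF R]] by (simp add: cc_set_def)
  moreover have "tube_pullback i (R - Id_on \<Gamma>) = tube_line i \<inter> step (R - Id_on \<Gamma>)"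
  proof (intro equalityI subrelI)
    fix a b assume ab: "(a, b) \<in> tube_line i \<inter> step (R - Id_on \<Gamma>)"
    then obtain j where j: "same_line j a b" "(a j, b j) \<in> R - Id_on \<Gamma>" by (auto simp: step_def)
    then have "a j \<noteq> b j" using Y.relation_subset[OF R] by auto
    moreover have "same_line i a b" using ab by (simp add: tube_line_def)
    ultimately have "i = j" using same_line_unique[OF j(1)] by blast
    then show "(a, b) \<in> tube_pullback i (R - Id_on \<Gamma>)"
      using ab j(2) by (simp add: pullback_def)
  qed (use i tube_tuples in \<open>auto simp: pullback_def tube_line_def step_def\<close>)
  then have "cc_relation Z (tube_pullback i (R - Id_on \<Gamma>))"
    by (simp add: Z.relation_Int relation_tube_line[OF i] relation_step Y.relation_Diff R Y.relation_Id)
  moreover have "tube_pullback i R = tube_pullback i (Id_on ?P) \<union> tube_pullback i (R - Id_on \<Gamma>)"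
    unfolding Y.Id_on_loops[OF R] by (auto simp: pullback_def)
  ultimately show ?thesis using Z.relation_Un by simp
qed

lemma coherent_quotient_tube:
  assumes i: "i \<in> {1..m}"
  shows "coherent_quotient (tuples m \<Gamma>) Z (tube_line i) (\<lambda>a. a i) \<Gamma>"
proof
  show "cc_relation Z (tube_line i)" by (rule relation_tube_line[OF i])
  show "sym (tube_line i)" "trans (tube_line i)"
    by (auto simp: sym_def trans_def tube_line_def same_line_def)
  have Domain: "Domain (tube_line i) = tube i" by (auto simp: tube_line_def same_line_def)
  then show "tube_line i \<noteq> {}" using box_nonempty box_subset_tube by blast
  show "(\<lambda>a. a i) ` (tube_line i `` {a}) = \<Gamma>" if "a \<in> Domain (tube_line i)" for a
  proof (intro equalityI subsetI)
    fix y assume "y \<in> \<Gamma>"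
    then have "(a, a(i := y)) \<in> tube_line i"
      using tube_upd[OF _ i] same_line_upd that unfolding Domain by (auto simp: tube_line_def)
    then show "y \<in> (\<lambda>a. a i) ` (tube_line i `` {a})" by (intro image_eqI[of _ _ "a(i := y)"]) auto
  qed (use tuples_mem[OF tube_tuples i] in \<open>auto simp: tube_line_def\<close>)
  have kernel: "tube_pullback i Id = Id_on (tube i)"
  proof -
    have "tube_pullback i Id = tube_pullback i (Id_on UNIV)"
      by (simp add: pullback_def Id_on_iff)
    then show ?thesis unfolding tube_pullback_Id_on by simp
  qed
  then show "cc_relation Z (tube_pullback i Id)"
    using Z.set_Domain[OF relation_tube_line[OF i]] by (simp add: Domain cc_set_def)
  fix a b assume "a \<in> Domain (tube_line i)" "b \<in> Domain (tube_line i)"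
  then have "Id_on (tube i) `` {a} = {a}" "Id_on (tube i) `` {b} = {b}" unfolding Domain by auto
  then show "card (tube_pullback i Id `` {a}) = card (tube_pullback i Id `` {b})"
    unfolding kernel by simp
qed

lemma set_tube_point:
  assumes base: "generalized_base \<Gamma> T PP" and i: "i \<in> {1..m}" and x: "x \<in> \<Gamma>"
    and PP: "\<And>P. P \<in> PP \<Longrightarrow> cc_set Z {b \<in> tube i. b i \<in> P}"
  shows "cc_set Z {b \<in> tube i. b i = x}"
proof -
  have "cc_relation Z (tube_pullback i (Id_on {x}))"
  proof (rule coherent_quotient.relation_lift_singleton[OF coherent_quotient_tube[OF i] base
        Y.basic_subset _ _ x])
    show "cc_relation Z (tube_pullback i t)" if "t \<in> T" for t
      by (rule relation_tube_pullback[OF i cc_relation_basic[OF that]])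
    show "cc_relation Z (tube_pullback i (Id_on P))" if "P \<in> PP" for P
      unfolding tube_pullback_Id_on using PP[OF that] by (simp add: cc_set_def)
  qed
  then show ?thesis unfolding tube_pullback_Id_on by (simp add: cc_set_def)
qed

lemma set_entry:
  assumes i: "i \<in> {1..m}" and x: "x \<in> \<Gamma>" and point: "cc_set Z {b \<in> tube i. b i = x}"
  shows "cc_set Z {a \<in> tuples m \<Gamma>. a i = x}"
proof -
  let ?R = "tube_line i \<inter> tuples m \<Gamma> \<times> {b \<in> tube i. b i = x}"
  have "{a \<in> tuples m \<Gamma>. a i = x} = Range (closer ?R)"
  proof (intro equalityI subsetI)
    fix a assume a: "a \<in> {a \<in> tuples m \<Gamma>. a i = x}"
    obtain q where q: "q \<in> tube i" using box_nonempty box_subset_tube by blast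
    obtain y where y: "y \<in> \<Gamma>" "y \<noteq> x" using ex_other_point[OF i] by blast
    let ?b = "q(i := y)" and ?c = "q(i := x)"
    have bc: "?b \<in> tube i" "?c \<in> tube i" "same_line i ?b ?c"
      using tube_upd[OF q i] x y(1) by (auto simp: same_line_def)
    then have "(?b, ?c) \<in> ?R" using tube_tuples by (auto simp: tube_line_def)
    moreover have "hamming {1..m} ?b a = hamming {1..m} ?c a + 1"
      using hamming_Suc_iff[OF _ i bc(3)] a y(2) by simp
    ultimately have "(?b, a) \<in> closer ?R"
      using a tube_tuples[OF bc(1)] unfolding closer_def by blast
    then show "a \<in> Range (closer ?R)" by blast
  next
    fix a assume "a \<in> Range (closer ?R)"
    then obtain b c where "a \<in> tuples m \<Gamma>" and bc: "same_line i b c" "c i = x"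
      and less: "hamming {1..m} b a = hamming {1..m} c a + 1" by (auto simp: closer_def tube_line_def)
    moreover have "c i = a i" using hamming_Suc_iff[OF _ i bc(1)] less by simp
    ultimately show "a \<in> {a \<in> tuples m \<Gamma>. a i = x}" by simp
  qed
  moreover have "cc_relation Z ?R"
    by (rule Z.relation_restrict[OF Z.set_full relation_tube_line[OF i] point])
  ultimately show ?thesis using Z.set_Range[OF relation_closer] by simp
qed

lemma complete_if_base:
  assumes base: "generalized_base \<Gamma> T PP"
    and PP: "\<And>i P. i \<in> {1..m} \<Longrightarrow> P \<in> PP \<Longrightarrow> cc_set Z {b \<in> tube i. b i \<in> P}"
  shows "cc_complete Z"
  unfolding Z.complete_iff
proof
  fix a assume a: "a \<in> tuples m \<Gamma>"
  have "cc_set Z {b \<in> tuples m \<Gamma>. \<forall>i\<in>I. b i = a i}" if "finite I" "I \<subseteq> {1..m}" for I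
    using that
  proof (induction I)
    case empty
    then show ?case using Z.set_full by simp
  next
    case (insert i I)
    then have i: "i \<in> {1..m}" by simp
    have "cc_set Z {b \<in> tuples m \<Gamma>. b i = a i}"
      by (intro set_entry set_tube_point[OF base] i tuples_mem[OF a] PP)
    moreover have "{b \<in> tuples m \<Gamma>. \<forall>j\<in>insert i I. b j = a j}
        = {b \<in> tuples m \<Gamma>. b i = a i} \<inter> {b \<in> tuples m \<Gamma>. \<forall>j\<in>I. b j = a j}" by auto
    ultimately show ?case using Z.set_Int insert.IH insert.prems by simp
  qed
  from this[of "{1..m}"] have "cc_set Z {b \<in> tuples m \<Gamma>. \<forall>i\<in>{1..m}. b i = a i}" by simp
  moreover have "{b \<in> tuples m \<Gamma>. \<forall>i\<in>{1..m}. b i = a i} = {a}" using a tuples_eqI by blast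
  ultimately show "cc_set Z {a}" by simp
qed

end

lemma (in exp_fission) exp_boxI_nonsets:
  assumes "cc_antisymmetric \<Gamma> T" "transitive_on m L" "cc_set Z (PiE {1..m} Q)"
    and Q: "\<And>i. i \<in> {1..m} \<Longrightarrow> Q i \<subseteq> \<Gamma>" "\<And>i. i \<in> {1..m} \<Longrightarrow> \<not> cc_set T (Q i)"
  shows "exp_box \<Gamma> T m L Z Q"
proof (unfold_locales; (intro notI | fact)?)
  fix i assume i: "i \<in> {1..m}"
  show False if "Q i = {}" using Q(2)[OF i] Y.set_empty that by simp
  show False if "\<Gamma> - Q i = {}"
  proof -
    have "Q i = \<Gamma>" using Q(1)[OF i] that by blast
    then show False using Q(2)[OF i] Y.set_full by simp
  qed
  fix j t assume "t \<in> T" "(\<Gamma> - Q i) \<times> Q i \<subseteq> t \<and> Q j \<times> (\<Gamma> - Q j) \<subseteq> t"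
  then show False using Y.antisymmetric_not_subset_basic[OF assms(1) Q(1)[OF i] Q(2)[OF i]] by blast
qed

lemma (in exp_fission) exp_boxI_set:
  assumes "cc_antisymmetric \<Gamma> T" "transitive_on m L" "cc_set T P" "P \<noteq> {}" "P \<noteq> \<Gamma>"
  shows "exp_box \<Gamma> T m L Z (\<lambda>_. P)"
proof unfold_locales
  have P: "P \<subseteq> \<Gamma>" by (rule Y.set_subset[OF assms(3)])
  then obtain x y where xy: "x \<in> \<Gamma> - P" "y \<in> P" using assms(4,5) by blast
  show "\<not> ((\<Gamma> - P) \<times> P \<subseteq> t \<and> P \<times> (\<Gamma> - P) \<subseteq> t)" if "t \<in> T" for t
    using Y.antisymmetric_basic[OF assms(1) that, of x y] xy by blast
qed (use assms Y.set_subset[OF assms(3)] set_power in auto)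

section \<open>Generalized bases of an exponentiation\<close>

lemma ex_enumeration:
  assumes "finite A" "card A \<le> n"
  obtains f :: "nat \<Rightarrow> 'b" where "A \<subseteq> f ` {..<n}" "range f \<subseteq> insert c A"
proof -
  obtain h where h: "bij_betw h {0..<card A} A" using ex_bij_betw_nat_finite[OF assms(1)] by blast
  let ?f = "\<lambda>k. if k < card A then h k else c"
  have "A \<subseteq> ?f ` {..<n}"
  proof
    fix x assume "x \<in> A"
    then have "x \<in> h ` {0..<card A}" using h by (simp add: bij_betw_def)
    then obtain k where "k < card A" "x = h k" by auto
    then show "x \<in> ?f ` {..<n}" using assms(2) by (intro image_eqI[of _ _ k]) auto
  qed
  moreover have "range ?f \<subseteq> insert c A" using h by (auto simp: bij_betw_def)
  ultimately show ?thesis by (rule that)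
qed

lemma (in coherent) gb_attained_nonsets:
  obtains PP where "generalized_base \<Omega> S PP" "card PP \<le> gb \<Omega> S" "finite PP"
    "\<And>P. P \<in> PP \<Longrightarrow> \<not> cc_set S P" "PP = {} \<longleftrightarrow> cc_complete S"
proof -
  obtain PP where PP: "generalized_base \<Omega> S PP" "card PP = gb \<Omega> S" "finite PP"
    using gb_attained[OF finite_points basic_subset] by blast
  let ?PP = "PP - {P. cc_set S P}"
  have base: "generalized_base \<Omega> S ?PP" by (rule generalized_base_Diff_sets[OF PP(1)])
  have "PP = {}" if "cc_complete S"
    using gb_le that PP(2,3) unfolding complete_iff_generalized_base_empty by fastforce
  moreover have "cc_complete S" if "?PP = {}"
    using base that unfolding complete_iff_generalized_base_empty by simp
  moreover have "card ?PP \<le> gb \<Omega> S" using card_mono[OF PP(3), of ?PP] PP(2) by auto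
  ultimately show ?thesis using that[of ?PP] base PP(3) by blast
qed

lemma (in coherent) ex_fiber:
  assumes "x \<in> \<Omega>"
  obtains \<Phi> where "Id_on \<Phi> \<in> S" "x \<in> \<Phi>"
proof -
  obtain s where s: "s \<in> S" "(x, x) \<in> s" using ex_basic assms by blast
  then have "s = Id_on (Domain s)" using basic_subset_Id by auto
  then show ?thesis using that[of "Domain s"] s by auto
qed

lemma (in coherent) complete_fiber:
  assumes "cc_complete S" "Id_on \<Phi> \<in> S" "x \<in> \<Phi>"
  shows "\<Phi> = {x}"
proof -
  obtain p where "Id_on \<Phi> = {p}" using assms(1,2) unfolding cc_complete_def by blast
  then have "(y, y) = p" if "y \<in> \<Phi>" for y using Id_onI[OF that] by simp
  then show ?thesis using assms(3) by blast
qed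

definition coded :: "'a set \<Rightarrow> 'a set \<Rightarrow> 'i set \<Rightarrow> 'i \<Rightarrow> 'a set" where
  "coded \<Phi> P D i = (if i \<in> D then P else sym_diff P \<Phi>)"

lemma coded_nonempty: "P \<noteq> {} \<Longrightarrow> P \<noteq> \<Phi> \<Longrightarrow> coded \<Phi> P D i \<noteq> {}"
  by (auto simp: coded_def)

lemma coded_subset: "P \<subseteq> \<Gamma> \<Longrightarrow> \<Phi> \<subseteq> \<Gamma> \<Longrightarrow> coded \<Phi> P D i \<subseteq> \<Gamma>"
  by (auto simp: coded_def)

lemma coded_cases: "P = coded \<Phi> P D i \<or> P = sym_diff (coded \<Phi> P D i) \<Phi>"
  by (auto simp: coded_def)

lemma (in coherent) coded_not_set:
  assumes "cc_set S \<Phi>" "\<not> cc_set S P"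
  shows "\<not> cc_set S (coded \<Phi> P D i)"
proof
  assume "cc_set S (coded \<Phi> P D i)"
  then have "cc_set S (sym_diff (coded \<Phi> P D i) \<Phi>)" using assms(1) by (intro set_Un set_Diff)
  then show False using coded_cases[of P \<Phi> D i] assms(2) \<open>cc_set S (coded \<Phi> P D i)\<close> by metis
qed

context exp_box
begin

lemma set_exits_coded:
  assumes antisymmetric: "cc_antisymmetric \<Gamma> T" and fiber: "Id_on \<Phi> \<in> T"
    and P: "P \<subseteq> \<Gamma>" "P \<noteq> {}" "P \<noteq> \<Phi>" and D: "D \<subseteq> {1..m}"
    and coded: "cc_set Z (PiE {1..m} (coded \<Phi> P D))"
  shows "cc_set Z (\<Union>i\<in>D. exit i)"
proof -
  have \<Phi>: "\<Phi> \<subseteq> \<Gamma>" using fiber Y.basic_subset by auto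
  then have "card (sym_diff P \<Phi>) \<noteq> card P"
    using Y.antisymmetric_odd_fiber[OF antisymmetric fiber] P(1) finite_subset Y.finite_points
    by (intro card_sym_diff_odd) blast+
  then have "{i \<in> {1..m}. card (coded \<Phi> P D i) = card P} = D"
    using D by (auto simp: coded_def)
  moreover have "coded \<Phi> P D i \<subseteq> \<Gamma> \<and> coded \<Phi> P D i \<noteq> {}" for i
    by (intro conjI coded_subset[OF P(1) \<Phi>] coded_nonempty[OF P(2,3)])
  ultimately show ?thesis
    using set_exits_card[OF _ coded, of "\<lambda>n. n = card P"] by simp
qed

lemma complete_if_coded:
  assumes antisymmetric: "cc_antisymmetric \<Gamma> T" and fiber: "Id_on \<Phi> \<in> T"
    and PP: "generalized_base \<Gamma> T PP" "PP \<subseteq> f ` K"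
    and DD: "generalized_base {1..m} (Inv_rels m L) DD" "DD \<subseteq> g ` K"
    and f: "\<And>k. k \<in> K \<Longrightarrow> f k \<subseteq> \<Gamma> \<and> f k \<noteq> {} \<and> f k \<noteq> \<Phi>"
    and coded: "\<And>k. k \<in> K \<Longrightarrow> cc_set Z (PiE {1..m} (coded \<Phi> (f k) (g k)))"
  shows "cc_complete Z"
proof -
  have \<Phi>: "cc_set T \<Phi>" by (rule Y.set_fiber[OF fiber])
  have "cc_set Z (\<Union>i\<in>D. exit i)" if D: "D \<in> DD" for D
  proof -
    obtain k where k: "k \<in> K" "D = g k" using DD(2) D by auto
    have "D \<subseteq> {1..m}" using DD(1) D by (auto simp: generalized_base_def)
    then show ?thesis
      using f[OF k(1)] coded[OF k(1)] k(2)
      by (intro set_exits_coded[OF antisymmetric fiber, of "f k"]) simp_all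
  qed
  then interpret exp_split \<Gamma> T m L Z Q
    by unfold_locales (rule set_exit_if_base[OF DD(1)])
  show ?thesis
  proof (rule complete_if_base[OF PP(1)])
    fix i P assume i: "i \<in> {1..m}" and "P \<in> PP"
    then obtain k where k: "k \<in> K" "P = f k" using PP(2) by auto
    let ?C = "coded \<Phi> P (g k)"
    have sub: "?C j \<subseteq> \<Gamma> \<and> ?C j \<noteq> {}" for j
      using f[OF k(1)] coded_subset[OF _ Y.set_subset[OF \<Phi>]] coded_nonempty k(2) by metis
    then have C: "cc_set Z {b \<in> tube i. b i \<in> ?C i}"
      using coded[OF k(1)] k(2) by (intro set_tube_slice[OF i] relation_slice) simp_all
    show "cc_set Z {b \<in> tube i. b i \<in> P}"
    proof (cases "P = ?C i")
      case False
      then have "{b \<in> tube i. b i \<in> P} = sym_diff {b \<in> tube i. b i \<in> ?C i} {b \<in> tube i. b i \<in> \<Phi>}"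
        using coded_cases[of P \<Phi> "g k" i] by auto
      then show ?thesis using C set_tube_set[OF i \<Phi>] Z.set_Un Z.set_Diff by simp
    qed (use C in simp)
  qed
qed

end

locale antisymmetric_exp =
  fixes \<Gamma> :: "'a set" and T :: "'a rel set" and m :: nat and L :: "(nat \<Rightarrow> nat) set"
  assumes coherent_T: "coherent_config \<Gamma> T" and antisymmetric: "cc_antisymmetric \<Gamma> T"
    and group: "perm_group_on m L" and transitive: "transitive_on m L"
begin

sublocale Y: coherent \<Gamma> T
  using coherent_T by unfold_locales

lemma generalized_base_expI:
  assumes "PP \<subseteq> Pow (tuples m \<Gamma>)"
    and "\<And>Z. exp_fission \<Gamma> T m L Z \<Longrightarrow> \<forall>P\<in>PP. cc_set Z P \<Longrightarrow> cc_complete Z"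
  shows "generalized_base (tuples m \<Gamma>) (exp_rels m \<Gamma> T L) PP"
  unfolding generalized_base_iff[OF finite_tuples[OF Y.finite_points] exp_rels_subset[OF group]]
  using assms coherent_T group by (simp add: exp_fission_def)

lemma generalized_base_coded:
  assumes fiber: "Id_on \<Phi> \<in> T" and f: "\<And>k. k \<in> K \<Longrightarrow> f k \<subseteq> \<Gamma> \<and> f k \<noteq> {} \<and> f k \<noteq> \<Phi>"
    and PP: "generalized_base \<Gamma> T PP" "PP \<subseteq> f ` K"
    and DD: "generalized_base {1..m} (Inv_rels m L) DD" "DD \<subseteq> g ` K"
    and box: "\<Phi> \<noteq> \<Gamma> \<or> (\<exists>k\<in>K. \<not> cc_set T (f k))"
  shows "generalized_base (tuples m \<Gamma>) (exp_rels m \<Gamma> T L)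
    ((\<lambda>k. PiE {1..m} (coded \<Phi> (f k) (g k))) ` K)"
proof (rule generalized_base_expI)
  have \<Phi>: "cc_set T \<Phi>" by (rule Y.set_fiber[OF fiber])
  note coded = coded_subset[OF _ Y.set_subset[OF \<Phi>]]
  show "(\<lambda>k. PiE {1..m} (coded \<Phi> (f k) (g k))) ` K \<subseteq> Pow (tuples m \<Gamma>)"
    unfolding tuples_def by (intro image_subsetI PowI PiE_mono coded) (use f in blast)
  fix Z assume Z: "exp_fission \<Gamma> T m L Z"
    and visible: "\<forall>P\<in>(\<lambda>k. PiE {1..m} (coded \<Phi> (f k) (g k))) ` K. cc_set Z P"
  interpret exp_fission \<Gamma> T m L Z by (rule Z)
  have "\<exists>Q. exp_box \<Gamma> T m L Z Q"
  proof (cases "\<Phi> = \<Gamma>")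
    case False
    have "\<Phi> \<noteq> {}" using Y.basic_nonempty[OF fiber] by auto
    then show ?thesis using exp_boxI_set[OF antisymmetric transitive \<Phi> _ False] by blast
  next
    case True
    then obtain k where k: "k \<in> K" "\<not> cc_set T (f k)" using box by blast
    then have "cc_set Z (PiE {1..m} (coded \<Phi> (f k) (g k)))" using visible by blast
    then have "exp_box \<Gamma> T m L Z (coded \<Phi> (f k) (g k))"
      by (rule exp_boxI_nonsets[OF antisymmetric transitive])
        (rule coded[OF conjunct1[OF f[OF k(1)]]], rule Y.coded_not_set[OF \<Phi> k(2)])
    then show ?thesis by blast
  qed
  then obtain Q where "exp_box \<Gamma> T m L Z Q" ..
  then show "cc_complete Z"
    using exp_box.complete_if_coded[OF _ antisymmetric fiber PP DD f] visible by blast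
qed

lemma tuples_trivial:
  assumes "\<Gamma> \<subseteq> {z}"
  obtains p where "tuples m \<Gamma> \<subseteq> {p}"
proof -
  have "a = b" if "a \<in> tuples m \<Gamma>" "b \<in> tuples m \<Gamma>" for a b
  proof (rule tuples_eqI[OF that])
    fix i assume "i \<in> {1..m}"
    then show "a i = b i" using tuples_mem that assms by blast
  qed
  then show ?thesis using that by blast
qed

lemma gb_exp_le_nontrivial:
  assumes nontrivial: "\<And>z. \<not> \<Gamma> \<subseteq> {z}"
  shows "gb (tuples m \<Gamma>) (exp_rels m \<Gamma> T L) \<le> max (gb \<Gamma> T) (gb {1..m} (Inv_rels m L))" (is "_ \<le> ?n")
proof -
  obtain z where "z \<in> \<Gamma>" using nontrivial by blast
  then obtain \<Phi> where fiber: "Id_on \<Phi> \<in> T" "z \<in> \<Phi>" by (rule Y.ex_fiber)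
  have \<Phi>: "cc_set T \<Phi>" by (rule Y.set_fiber[OF fiber(1)])
  have proper: "\<Phi> \<noteq> \<Gamma>" if "cc_complete T"
    using Y.complete_fiber[OF that fiber] nontrivial[of z] by auto
  obtain PP where PP: "generalized_base \<Gamma> T PP" "card PP \<le> gb \<Gamma> T" "finite PP"
    "\<And>P. P \<in> PP \<Longrightarrow> \<not> cc_set T P" "PP = {} \<longleftrightarrow> cc_complete T"
    using Y.gb_attained_nonsets by blast
  obtain c where c: "c \<in> PP \<or> cc_complete T \<and> c = \<Gamma>" using PP(5) by blast
  have "card PP \<le> ?n" using PP(2) by simp
  then obtain f where f: "PP \<subseteq> f ` {..<?n}" "range f \<subseteq> insert c PP"
    by (rule ex_enumeration[OF PP(3)])
  obtain DD where DD: "generalized_base {1..m} (Inv_rels m L) DD"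
    "card DD = gb {1..m} (Inv_rels m L)" "finite DD"
    using gb_attained[OF finite_atLeastAtMost Inv_rels_subset[OF group]] by blast
  have "card DD \<le> ?n" using DD(2) by simp
  then obtain g where g: "DD \<subseteq> g ` {..<?n}" by (rule ex_enumeration[OF DD(3)])
  let ?W = "(\<lambda>k. PiE {1..m} (coded \<Phi> (f k) (g k))) ` {..<?n}"
  have "generalized_base (tuples m \<Gamma>) (exp_rels m \<Gamma> T L) ?W"
  proof (rule generalized_base_coded[OF fiber(1) _ PP(1) f(1) DD(1) g])
    fix k
    have "f k \<in> PP \<or> cc_complete T \<and> f k = \<Gamma>" using subsetD[OF f(2) rangeI[of f k]] c by auto
    then show "f k \<subseteq> \<Gamma> \<and> f k \<noteq> {} \<and> f k \<noteq> \<Phi>"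
    proof
      assume "f k \<in> PP"
      then show ?thesis using PP(1,4) \<Phi> Y.set_empty by (auto simp: generalized_base_def)
    qed (use proper \<open>z \<in> \<Gamma>\<close> in auto)
  qed (use proper PP(4,5) f(1) in blast)
  then have "gb (tuples m \<Gamma>) (exp_rels m \<Gamma> T L) \<le> card ?W" by (rule gb_le)
  also have "\<dots> \<le> ?n" using card_image_le[of "{..<?n}"] by simp
  finally show ?thesis .
qed

theorem gb_exp_le: "gb (tuples m \<Gamma>) (exp_rels m \<Gamma> T L) \<le> max (gb \<Gamma> T) (gb {1..m} (Inv_rels m L))"
proof (cases "\<exists>z. \<Gamma> \<subseteq> {z}")
  case True
  then obtain p where "tuples m \<Gamma> \<subseteq> {p}" using tuples_trivial by blast
  then show ?thesis
    using gb_trivial[OF finite_tuples[OF Y.finite_points] exp_rels_subset[OF group]] by simp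
qed (use gb_exp_le_nontrivial in blast)

end

section \<open>Bases of an exponentiation\<close>

definition encodes :: "nat \<Rightarrow> 'a rel set \<Rightarrow> (nat \<Rightarrow> 'a) set \<Rightarrow> nat set \<Rightarrow> bool" where
  "encodes m T X D \<longleftrightarrow> (\<exists>a\<in>X. \<exists>b\<in>X. \<exists>R. cc_relation T R \<and> D = {i \<in> {1..m}. (a i, b i) \<in> R})"

definition covers :: "nat \<Rightarrow> (nat \<Rightarrow> 'a) set \<Rightarrow> 'a set \<Rightarrow> bool" where
  "covers m X A \<longleftrightarrow> (\<forall>x\<in>A. \<forall>i\<in>{1..m}. \<exists>a\<in>X. a i = x)"

context exp_box
begin

lemma complete_if_encodes:
  assumes A: "generalized_base \<Gamma> T ((\<lambda>x. {x}) ` A)" "covers m X A"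
    and DD: "generalized_base {1..m} (Inv_rels m L) DD" "\<And>D. D \<in> DD \<Longrightarrow> encodes m T X D"
    and X: "\<And>a. a \<in> X \<Longrightarrow> cc_set Z {a}"
  shows "cc_complete Z"
proof -
  have tuple: "a \<in> tuples m \<Gamma>" if "a \<in> X" for a using Z.set_subset[OF X[OF that]] by blast
  have point: "{a i} \<subseteq> \<Gamma>" if "a \<in> X" "i \<in> {1..m}" for a i using tuples_mem[OF tuple] that by blast
  have slice: "cc_relation Z (slice (\<lambda>i. {a i}))" if "a \<in> X" for a
    using point[OF that] X[OF that] PiE_singleton_tuple[OF tuple[OF that]]
    by (intro relation_slice) simp_all
  have "cc_set Z (\<Union>i\<in>D. exit i)" if D: "D \<in> DD" for D
  proof -
    obtain a b R where ab: "a \<in> X" "b \<in> X" and R: "cc_relation T R"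
      and "D = {i \<in> {1..m}. (a i, b i) \<in> R}" using DD(2)[OF D] by (auto simp: encodes_def)
    then have "D = {i \<in> {1..m}. {a i} \<times> {b i} \<inter> R \<noteq> {}}" by auto
    then show ?thesis
      using set_exits_type[OF R point[OF ab(1)] slice[OF ab(1)] point[OF ab(2)] slice[OF ab(2)]]
      by simp
  qed
  then interpret exp_split \<Gamma> T m L Z Q
    by unfold_locales (rule set_exit_if_base[OF DD(1)])
  show ?thesis
  proof (rule complete_if_base[OF A(1)])
    fix i P assume i: "i \<in> {1..m}" and "P \<in> (\<lambda>x. {x}) ` A"
    then obtain x where x: "x \<in> A" "P = {x}" by blast
    then obtain a where "a \<in> X" "a i = x" using A(2) i unfolding covers_def by blast
    then have a: "a \<in> X" "P = {a i}" using x(2) by simp_all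
    then show "cc_set Z {b \<in> tube i. b i \<in> P}"
      using set_tube_slice[OF i slice[OF a(1)] point[OF a(1) i]] by simp
  qed
qed

end

lemma (in antisymmetric_exp) cc_base_exp:
  assumes A: "generalized_base \<Gamma> T ((\<lambda>x. {x}) ` A)" "covers m X A"
    and DD: "generalized_base {1..m} (Inv_rels m L) DD" "\<And>D. D \<in> DD \<Longrightarrow> encodes m T X D"
    and X: "X \<subseteq> tuples m \<Gamma>" and a: "a \<in> X" "\<And>i. i \<in> {1..m} \<Longrightarrow> \<not> cc_set T {a i}"
  shows "cc_base (tuples m \<Gamma>) (exp_rels m \<Gamma> T L) X"
proof -
  have "generalized_base (tuples m \<Gamma>) (exp_rels m \<Gamma> T L) ((\<lambda>a. {a}) ` X)"
  proof (rule generalized_base_expI)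
    fix Z assume Z: "exp_fission \<Gamma> T m L Z" and visible: "\<forall>P\<in>(\<lambda>a. {a}) ` X. cc_set Z P"
    interpret exp_fission \<Gamma> T m L Z by (rule Z)
    have tuple: "a \<in> tuples m \<Gamma>" using X a(1) by blast
    then have "cc_set Z (PiE {1..m} (\<lambda>i. {a i}))"
      using visible a(1) by (simp add: PiE_singleton_tuple)
    then have "exp_box \<Gamma> T m L Z (\<lambda>i. {a i})"
      by (rule exp_boxI_nonsets[OF antisymmetric transitive])
        (use tuples_mem[OF tuple] a(2) in auto)
    then show "cc_complete Z" using visible by (intro exp_box.complete_if_encodes[OF _ A DD]) auto
  qed (use X in auto)
  then show ?thesis using X by (simp add: cc_base_def)
qed

definition partner :: "nat \<Rightarrow> nat \<Rightarrow> nat" where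
  "partner n j = (if odd j then j - 1 else if j + 1 < n then j + 1 else j)"

lemma partner_less: "j < n \<Longrightarrow> partner n j < n"
  and partner_div_2: "partner n j div 2 = j div 2"
  and partner_partner: "j < n \<Longrightarrow> partner n (partner n j) = j"
  by (auto simp: partner_def elim!: evenE oddE)

definition swapped_tuple :: "nat \<Rightarrow> nat \<Rightarrow> (nat \<Rightarrow> 'a) \<Rightarrow> (nat \<Rightarrow> nat set) \<Rightarrow> nat \<Rightarrow> nat \<Rightarrow> 'a" where
  "swapped_tuple m n \<beta> D j = (\<lambda>i\<in>{1..m}. if i \<in> D (j div 2) then \<beta> j else \<beta> (partner n j))"

lemma swapped_tuple_mem: "j < n \<Longrightarrow> i \<in> {1..m} \<Longrightarrow> swapped_tuple m n \<beta> D j i \<in> \<beta> ` {..<n}"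
  using partner_less[of j n] by (simp add: swapped_tuple_def)

lemma covers_swapped_tuples: "covers m (swapped_tuple m n \<beta> D ` {..<n}) (\<beta> ` {..<n})"
  unfolding covers_def
proof (intro ballI)
  fix x i assume "x \<in> \<beta> ` {..<n}" and i: "i \<in> {1..m}"
  then obtain j where j: "j < n" "x = \<beta> j" by blast
  have "swapped_tuple m n \<beta> D (if i \<in> D (j div 2) then j else partner n j) i = x"
    using j i by (simp add: swapped_tuple_def partner_div_2 partner_partner)
  then show "\<exists>a\<in>swapped_tuple m n \<beta> D ` {..<n}. a i = x" using j(1) partner_less[OF j(1)] by force
qed

lemma (in coherent) encodes_swapped_tuples:
  assumes antisymmetric: "cc_antisymmetric \<Omega> S" and \<beta>: "inj_on \<beta> {..<n}" "\<beta> ` {..<n} \<subseteq> \<Omega>"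
    and D: "D j \<subseteq> {1..m}" and j: "j < n div 2"
  shows "encodes m S (swapped_tuple m n \<beta> D ` {..<n}) (D j)"
proof -
  have less: "2 * j < n" "2 * j + 1 < n" using j by auto
  have neq: "\<beta> (2 * j) \<noteq> \<beta> (2 * j + 1)" using inj_onD[OF \<beta>(1), of "2 * j" "2 * j + 1"] less by auto
  obtain s where s: "s \<in> S" "(\<beta> (2 * j), \<beta> (2 * j + 1)) \<in> s" using ex_basic \<beta>(2) less by blast
  have "(\<beta> (2 * j + 1), \<beta> (2 * j)) \<notin> s" using antisymmetric_basic[OF antisymmetric s] neq by blast
  moreover have "partner n (2 * j) = 2 * j + 1" "partner n (2 * j + 1) = 2 * j"
    using less by (simp_all add: partner_def)
  ultimately have "D j = {i \<in> {1..m}.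
      (swapped_tuple m n \<beta> D (2 * j) i, swapped_tuple m n \<beta> D (2 * j + 1) i) \<in> s}"
    using D s(2) by (auto simp: swapped_tuple_def)
  then show ?thesis unfolding encodes_def using less cc_relation_basic[OF s(1)] by blast
qed

definition modified_tuple :: "nat \<Rightarrow> nat set \<Rightarrow> ('a \<Rightarrow> 'a) \<Rightarrow> (nat \<Rightarrow> 'a) \<Rightarrow> nat \<Rightarrow> 'a" where
  "modified_tuple m D \<delta> a = (\<lambda>i\<in>{1..m}. if i \<in> D then a i else \<delta> (a i))"

lemma (in coherent) encodes_modified_tuple:
  assumes "a \<in> X" "modified_tuple m D \<delta> a \<in> X" "a \<in> tuples m \<Omega>" "D \<subseteq> {1..m}"
    and "\<And>i. i \<in> {1..m} \<Longrightarrow> \<delta> (a i) \<noteq> a i"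
  shows "encodes m S X D"
proof -
  have "D = {i \<in> {1..m}. (a i, modified_tuple m D \<delta> a i) \<in> Id_on \<Omega>}"
    using assms(4,5) tuples_mem[OF assms(3)] by (force simp: modified_tuple_def Id_on_iff)
  then show ?thesis unfolding encodes_def using assms(1,2) relation_Id by blast
qed

definition encoding_tuples ::
  "nat \<Rightarrow> nat \<Rightarrow> (nat \<Rightarrow> 'a) \<Rightarrow> nat \<Rightarrow> (nat \<Rightarrow> nat set) \<Rightarrow> ('a \<Rightarrow> 'a) \<Rightarrow> (nat \<Rightarrow> 'a) set" where
  "encoding_tuples m n \<beta> b D \<delta> = swapped_tuple m n \<beta> D ` {..<n} \<union>
    (\<lambda>j. modified_tuple m (D j) \<delta> (swapped_tuple m n \<beta> D 0)) ` {n div 2..<b}"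

lemma card_encoding_tuples_le: "card (encoding_tuples m n \<beta> b D \<delta>) \<le> n + (b - n div 2)"
proof -
  have "card (encoding_tuples m n \<beta> b D \<delta>) \<le> card (swapped_tuple m n \<beta> D ` {..<n}) +
      card ((\<lambda>j. modified_tuple m (D j) \<delta> (swapped_tuple m n \<beta> D 0)) ` {n div 2..<b})"
    unfolding encoding_tuples_def by (rule card_Un_le)
  also have "\<dots> \<le> card {..<n} + card {n div 2..<b}" by (intro add_mono card_image_le) simp_all
  finally show ?thesis by simp
qed

lemma swapped_tuple_tuples: "j < n \<Longrightarrow> \<beta> ` {..<n} \<subseteq> \<Omega> \<Longrightarrow> swapped_tuple m n \<beta> D j \<in> tuples m \<Omega>"
  using partner_less[of j n] by (auto simp: swapped_tuple_def tuples_def)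

lemma encoding_tuples_subset:
  assumes "0 < n" "\<beta> ` {..<n} \<subseteq> \<Omega>" "\<And>x. x \<in> \<beta> ` {..<n} \<Longrightarrow> \<delta> x \<in> \<Omega>"
  shows "encoding_tuples m n \<beta> b D \<delta> \<subseteq> tuples m \<Omega>"
proof -
  have "modified_tuple m E \<delta> (swapped_tuple m n \<beta> D 0) \<in> tuples m \<Omega>" for E
  proof -
    have "swapped_tuple m n \<beta> D 0 i \<in> \<Omega> \<and> \<delta> (swapped_tuple m n \<beta> D 0 i) \<in> \<Omega>" if "i \<in> {1..m}" for i
      using swapped_tuple_mem[OF assms(1) that, of \<beta> D] assms(2,3) by blast
    then show ?thesis by (auto simp: modified_tuple_def tuples_def)
  qed
  then show ?thesis using swapped_tuple_tuples[OF _ assms(2)] by (auto simp: encoding_tuples_def)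
qed

lemma (in coherent) encodes_encoding_tuples:
  assumes antisymmetric: "cc_antisymmetric \<Omega> S" and n: "0 < n"
    and \<beta>: "inj_on \<beta> {..<n}" "\<beta> ` {..<n} \<subseteq> \<Omega>" and \<delta>: "\<And>x. x \<in> \<beta> ` {..<n} \<Longrightarrow> \<delta> x \<noteq> x"
    and D: "D j \<subseteq> {1..m}" and j: "j < b"
  shows "encodes m S (encoding_tuples m n \<beta> b D \<delta>) (D j)"
proof (cases "j < n div 2")
  case True
  then show ?thesis
    using encodes_swapped_tuples[of \<beta> n D j m, OF antisymmetric \<beta> D]
    unfolding encodes_def encoding_tuples_def by blast
next
  case False
  let ?a = "swapped_tuple m n \<beta> D 0"
  have "?a \<in> encoding_tuples m n \<beta> b D \<delta>"
    "modified_tuple m (D j) \<delta> ?a \<in> encoding_tuples m n \<beta> b D \<delta>"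
    using False n j by (auto simp: encoding_tuples_def)
  moreover have "?a \<in> tuples m \<Omega>" by (rule swapped_tuple_tuples[OF n \<beta>(2)])
  ultimately show ?thesis
    by (rule encodes_modified_tuple) (rule D, rule \<delta>[OF swapped_tuple_mem[OF n]])
qed

lemma (in coherent) ex_encoding_tuples:
  assumes antisymmetric: "cc_antisymmetric \<Omega> S" and A: "A \<subseteq> \<Omega>" "A \<noteq> {}"
    and nontrivial: "\<And>x. x \<in> A \<Longrightarrow> \<exists>y\<in>\<Omega>. y \<noteq> x" and DD: "DD \<subseteq> Pow {1..m}"
  obtains X a where "X \<subseteq> tuples m \<Omega>" "card X \<le> card A + (card DD - card A div 2)"
    "covers m X A" "\<And>D. D \<in> DD \<Longrightarrow> encodes m S X D" "a \<in> X" "\<And>i. i \<in> {1..m} \<Longrightarrow> a i \<in> A"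
proof -
  let ?n = "card A" and ?b = "card DD"
  have finA: "finite A" using A(1) finite_points finite_subset by blast
  then have n: "0 < ?n" using A(2) by (simp add: card_gt_0_iff)
  obtain \<beta> where "bij_betw \<beta> {0..<?n} A" using ex_bij_betw_nat_finite[OF finA] by blast
  then have \<beta>: "inj_on \<beta> {..<?n}" "\<beta> ` {..<?n} = A"
    by (simp_all add: bij_betw_def lessThan_atLeast0)
  have "finite DD" using DD finite_subset by auto
  then obtain D where D: "DD \<subseteq> D ` {..<?b}" "range D \<subseteq> insert {} DD"
    using ex_enumeration[of DD ?b] by blast
  obtain \<delta> where \<delta>: "\<And>x. x \<in> A \<Longrightarrow> \<delta> x \<in> \<Omega> \<and> \<delta> x \<noteq> x" using nontrivial by metis
  let ?X = "encoding_tuples m ?n \<beta> ?b D \<delta>" and ?a = "swapped_tuple m ?n \<beta> D 0"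
  show ?thesis
  proof (rule that[of ?X ?a])
    show "?X \<subseteq> tuples m \<Omega>" using n \<beta>(2) A(1) \<delta> by (intro encoding_tuples_subset) auto
    show "card ?X \<le> ?n + (?b - ?n div 2)" by (rule card_encoding_tuples_le)
    show "covers m ?X A"
      using covers_swapped_tuples[of m ?n \<beta> D] unfolding \<beta>(2) covers_def encoding_tuples_def
      by blast
    fix E assume "E \<in> DD"
    then obtain j where j: "j < ?b" "E = D j" using D(1) by auto
    have "D j \<subseteq> {1..m}" using D(2) DD by blast
    then show "encodes m S ?X E"
      unfolding j(2) using \<beta> A(1) \<delta>
      by (intro encodes_encoding_tuples[OF antisymmetric n _ _ _ _ j(1)]) auto
  next
    show "?a \<in> ?X" using n by (auto simp: encoding_tuples_def)
    show "?a i \<in> A" if "i \<in> {1..m}" for i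
      using swapped_tuple_mem[OF n that, of \<beta> D] \<beta>(2) by simp
  qed
qed

theorem (in antisymmetric_exp) bnum_exp_le:
  assumes "\<not> cc_complete T"
  shows "bnum (tuples m \<Gamma>) (exp_rels m \<Gamma> T L)
    \<le> bnum \<Gamma> T + (gb {1..m} (Inv_rels m L) - bnum \<Gamma> T div 2)"
proof -
  obtain DD where DD: "generalized_base {1..m} (Inv_rels m L) DD"
    "card DD = gb {1..m} (Inv_rels m L)"
    using gb_attained[OF finite_atLeastAtMost Inv_rels_subset[OF group]] by blast
  obtain A where A: "cc_base \<Gamma> T A" "card A = bnum \<Gamma> T"
    using bnum_attained[OF Y.finite_points Y.basic_subset] by blast
  then have base: "A \<subseteq> \<Gamma>" "generalized_base \<Gamma> T ((\<lambda>x. {x}) ` A)" by (simp_all add: cc_base_def)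
  have "A \<noteq> {}" using base(2) assms Y.complete_iff_generalized_base_empty by auto
  moreover have "\<exists>y\<in>\<Gamma>. y \<noteq> x" for x using Y.complete_if_trivial[of x] assms by blast
  moreover have "DD \<subseteq> Pow {1..m}" using DD(1) by (simp add: generalized_base_def)
  ultimately obtain X a where X: "X \<subseteq> tuples m \<Gamma>" "card X \<le> card A + (card DD - card A div 2)"
    "covers m X A" "\<And>D. D \<in> DD \<Longrightarrow> encodes m T X D" and a: "a \<in> X" "\<And>i. i \<in> {1..m} \<Longrightarrow> a i \<in> A"
    using Y.ex_encoding_tuples[OF antisymmetric base(1)] by metis
  have "cc_base (tuples m \<Gamma>) (exp_rels m \<Gamma> T L) X"
    using cc_base_exp[OF base(2) X(3) DD(1) X(4,1) a(1)] Y.minimal_base_not_set[OF A] a(2) by blast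
  then have "bnum (tuples m \<Gamma>) (exp_rels m \<Gamma> T L) \<le> card X" by (rule bnum_le)
  then show ?thesis using X(2) unfolding A(2) DD(2) by linarith
qed

lemma ceiling_half_pred: "\<lceil>(real k - 1) / 2\<rceil> = int (k div 2)"
proof (cases "even k")
  case True
  then obtain h where "k = 2 * h" by (elim evenE)
  then show ?thesis by (intro ceiling_unique) (auto simp: field_simps)
next
  case False
  then obtain h where "k = 2 * h + 1" by (elim oddE)
  then show ?thesis by simp
qed

theorem theorem7p1:
  fixes \<Gamma> :: "'a set" and T :: "'a rel set" and m :: nat and L :: "(nat \<Rightarrow> nat) set"
  assumes "coherent_config \<Gamma> T"
    and "cc_antisymmetric \<Gamma> T"
    and "perm_group_on m L"
    and "transitive_on m L"
    and "odd (card L)"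
  shows "gb (tuples m \<Gamma>) (exp_rels m \<Gamma> T L) \<le> max (gb \<Gamma> T) (gb {1..m} (Inv_rels m L))
    \<and> (\<not> cc_complete T \<longrightarrow>
        int (bnum (tuples m \<Gamma>) (exp_rels m \<Gamma> T L))
          \<le> int (bnum \<Gamma> T) + max 0 (int (gb {1..m} (Inv_rels m L))
                 - ceiling ((real (bnum \<Gamma> T) - 1) / 2)))"
proof -
  interpret antisymmetric_exp \<Gamma> T m L
    using assms(1-4) by unfold_locales
  show ?thesis
  proof (intro conjI impI)
    show "gb (tuples m \<Gamma>) (exp_rels m \<Gamma> T L) \<le> max (gb \<Gamma> T) (gb {1..m} (Inv_rels m L))"
      by (rule gb_exp_le)
    assume "\<not> cc_complete T"
    then show "int (bnum (tuples m \<Gamma>) (exp_rels m \<Gamma> T L))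
        \<le> int (bnum \<Gamma> T) + max 0 (int (gb {1..m} (Inv_rels m L))
          - ceiling ((real (bnum \<Gamma> T) - 1) / 2))"
      unfolding ceiling_half_pred using bnum_exp_le by linarith
  qed
qed

end
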